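(* Consider the following Poisson bipolar network with frequency-hopping multiple access (FHMA) using an integer number $N\ge 1$ of sub-bands. Then the mean local delay is $$D(N)=N\exp\left(\frac{A}{(N-1)^{1-\delta}N^{\delta}}+\frac{B}{N}\right),$$ where $A=\lambda c_d r_0^d\theta^{\delta}C(\delta)$ and $B=\theta r_0^\alpha W N_0$ (for $N=1$ the right-hand side is interpreted as $+\infty$, i.e. $D(1)=\infty$).
   Context: Network model: transmitters form a homogeneous Poisson point process $\Phi$ of intensity $\lambda>0$ in $\mathbb{R}^d$. The typical receiver is at the origin and its desired transmitter $x_0\in\Phi$ is at distance $r_0=|x_0|>0$; all probabilities and expectations are under the Palm distribution of $\Phi$ at $x_0$ (equivalently, $\Phi\setminus\{x_0\}$ is a Poisson point process of intensity $\lambda$). Time is divided into slots $k=1,2,\dots$. Path loss is $\kappa r^{-\alpha}$ with $\alpha>d$; set $\delta=d/\alpha\in(0,1)$. Power fading coefficients $h_{k,x}$ (from transmitter $x$ to the origin in slot $k$) are i.i.d. exponential with mean $1$ over $x$ and $k$, independent of everything else. All transmitters use unit power and always have data. The total bandwidth is $W$, thermal noise has power spectral density $N_r$, and $N_0=N_r/\kappa$. SINR threshold $\theta>0$. FHMA: in each slot $k$, each transmitter $x$ independently picks a sub-band $\mathcal{S}_k(x)$ uniformly at random from $\{1,\dots,N\}$, independently over transmitters and slots and of $\Phi$ and fading. The SINR in slot $k$ is $$\mathrm{SINR}_k=\frac{h_{k,x_0}r_0^{-\alpha}}{\frac{WN_0}{N}+\sum_{x\in\Phi\setminus\{x_0\}}h_{k,x}|x|^{-\alpha}\mathbf{1}(\mathcal{S}_k(x)=\mathcal{S}_k(x_0))},$$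 and slot $k$ is successful if $\mathrm{SINR}_k>\theta$. A packet requires $N$ successful slots; the local delay is the number of slots until the $N$-th successful slot, and $D(N)$ denotes its expectation. Notation: $c_d$ is the volume of the unit ball in $\mathbb{R}^d$, and $C(\delta)=\Gamma(1+\delta)\Gamma(1-\delta)=\frac{\pi\delta}{\sin(\pi\delta)}$. *)

theory Defs
  imports "HOL-Probability.Probability"
begin

definition events_of :: "'w measure \<Rightarrow> 'b measure \<Rightarrow> ('w \<Rightarrow> 'b) \<Rightarrow> 'w set set" where
  "events_of M N f = {f -` A \<inter> space M | A. A \<in> sets N}"

definition ppp_count :: "(nat \<Rightarrow> 'w \<Rightarrow> 'a) \<Rightarrow> 'a set \<Rightarrow> 'w \<Rightarrow> nat" where
  "ppp_count X B \<omega> = card {i. X i \<omega> \<in> B}"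

definition poisson_point_process ::
  "'w measure \<Rightarrow> real \<Rightarrow> (nat \<Rightarrow> 'w \<Rightarrow> 'a::euclidean_space) \<Rightarrow> bool" where
  "poisson_point_process M lam X \<longleftrightarrow>
     (\<forall>i. X i \<in> borel_measurable M) \<and>
     (AE \<omega> in M. inj (\<lambda>i. X i \<omega>)) \<and>
     (\<forall>B. B \<in> sets borel \<and> bounded B \<longrightarrow>
        (AE \<omega> in M. finite {i. X i \<omega> \<in> B}) \<and>
        (\<forall>k. measure M {\<omega> \<in> space M. ppp_count X B \<omega> = k} =
              (lam * measure lborel B) ^ k / fact k * exp (- (lam * measure lborel B)))) \<and>
     (\<forall>(B :: nat \<Rightarrow> 'a set) n.
        (\<forall>j<n. B j \<in> sets borel \<and> bounded (B j)) \<and> disjoint_family_on B {..<n} \<longrightarrow>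
        prob_space.indep_vars M (\<lambda>_. count_space UNIV) (\<lambda>j. ppp_count X (B j)) {..<n})"

text \<open>Index set for the independent random ingredients of the FHMA model:
  the interferer point process, interferer fadings h k i (slot k, interferer i),
  desired-link fadings, interferer sub-band choices, desired-link sub-band choices.\<close>
datatype fh_idx = Pts | Fad nat nat | Fad0 nat | Hop nat nat | Hop0 nat

definition fh_interference ::
  "(nat \<Rightarrow> 'w \<Rightarrow> 'a::euclidean_space) \<Rightarrow> (nat \<Rightarrow> nat \<Rightarrow> 'w \<Rightarrow> real) \<Rightarrow>
   (nat \<Rightarrow> nat \<Rightarrow> 'w \<Rightarrow> nat) \<Rightarrow> (nat \<Rightarrow> 'w \<Rightarrow> nat) \<Rightarrow> real \<Rightarrow> nat \<Rightarrow> 'w \<Rightarrow> ennreal" where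
  "fh_interference X h S S0 \<alpha> k \<omega> =
     (\<Sum>i. ennreal (h k i \<omega> * norm (X i \<omega>) powr (- \<alpha>)) *
            (if S k i \<omega> = S0 k \<omega> then 1 else 0))"

text \<open>Slot k is successful iff SINR_k > theta, i.e.
  h0 r0^(-alpha) > theta (W N0 / N + I_k).\<close>
definition fh_success ::
  "(nat \<Rightarrow> 'w \<Rightarrow> 'a::euclidean_space) \<Rightarrow> (nat \<Rightarrow> nat \<Rightarrow> 'w \<Rightarrow> real) \<Rightarrow> (nat \<Rightarrow> 'w \<Rightarrow> real) \<Rightarrow>
   (nat \<Rightarrow> nat \<Rightarrow> 'w \<Rightarrow> nat) \<Rightarrow> (nat \<Rightarrow> 'w \<Rightarrow> nat) \<Rightarrow>
   real \<Rightarrow> real \<Rightarrow> real \<Rightarrow> nat \<Rightarrow> real \<Rightarrow> real \<Rightarrow> nat \<Rightarrow> 'w \<Rightarrow> bool" where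
  "fh_success X h h0 S S0 \<alpha> r0 \<theta> N W N0 k \<omega> \<longleftrightarrow>
     ennreal \<theta> * (ennreal (W * N0 / real N) + fh_interference X h S S0 \<alpha> k \<omega>)
       < ennreal (h0 k \<omega> * r0 powr (- \<alpha>))"

definition local_delay :: "(nat \<Rightarrow> 'w \<Rightarrow> bool) \<Rightarrow> nat \<Rightarrow> 'w \<Rightarrow> ennreal" where
  "local_delay succ N \<omega> =
     (if \<exists>n. N \<le> card {k. k < n \<and> succ k \<omega>}
      then ennreal (real (LEAST n. N \<le> card {k. k < n \<and> succ k \<omega>}))
      else \<infinity>)"

end

(*
  Condition on the interferer locations x_i. Slots are then independent with a common success
  probability p, so the mean number of slots is N / p. Exponential fading turns p into a Laplace
  transform, 1 / p = exp(B/N) prod_i (1 + u(x_i)) with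
  u(x) = (s/N) / (1 + s (N-1)/N), s = theta r0^alpha |x|^(-alpha). Averaging over the Poisson
  process with its probability generating functional gives exp(lambda int u); the integral is a
  Beta integral for N >= 2 and diverges at the origin for N = 1.
*)
theory Submission
  imports Defs
begin

section \<open>Radial integrals\<close>

text \<open>The obstacle is that nothing may be assumed finite: for a frozen configuration the
  interference can be infinite and the success probability 0, and for N = 1 the mean itself is
  infinite. Everything is therefore computed in [0, \<infinity>], where 1 / 0 is \<infinity>, and
  infinite products are suprema of partial products. The reciprocal of the success probability is
  the convenient quantity: its factors 1 + u(x_i) are at least 1, so the partial products increase,
  monotone convergence applies without any integrability condition, and N = 1 and N \<ge> 2 separate
  only in the final integral of u. The form of u comes from a single interferer. It sits in another
  sub-band with probability 1 - 1/N; otherwise it multiplies the success probability by 1 / (1 + s),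
  the Laplace transform of a unit exponential. Thus 1 + u is the reciprocal of 1 - 1/N + (1/N) / (1
  + s). For N \<ge> 2 the denominator of u keeps it bounded near the origin, where s blows
  up.\<close>

lemma emeasure_lborel_ball_powr:
  assumes "0 \<le> \<rho>" and "\<alpha> > 0"
  shows "emeasure lborel (ball (0::'a::euclidean_space) (\<rho> powr (1 / \<alpha>))) =
    ennreal (measure lborel (ball (0::'a) 1) * \<rho> powr (real DIM('a) / \<alpha>))"
proof -
  have "(\<rho> powr (1 / \<alpha>)) ^ DIM('a) = \<rho> powr (real DIM('a) / \<alpha>)"
    using assms by (cases "\<rho> = 0") (simp_all add: powr_realpow[symmetric] powr_powr)
  then show ?thesis
    by (simp add: emeasure_ball content_ball)
qed

text \<open>Layer-cake: the superlevel sets of the integrand are balls, whose volumes integrate to a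
  Beta function.\<close>
lemma nn_integral_radial_Gamma:
  fixes \<alpha> b :: real
  assumes \<alpha>: "\<alpha> > real DIM('a::euclidean_space)" and b: "b > 0"
  defines "\<delta> \<equiv> real DIM('a) / \<alpha>"
  shows "(\<integral>\<^sup>+ x. ennreal (b / (b + norm (x::'a) powr \<alpha>)) \<partial>lborel) =
    ennreal (measure lborel (ball (0::'a) 1) * b powr \<delta> * (Gamma (1 + \<delta>) * Gamma (1 - \<delta>)))"
proof -
  define c where "c = measure lborel (ball (0::'a) 1)"
  define f :: "'a \<Rightarrow> real" where "f x = b / (b + norm x powr \<alpha>)" for x
  have [measurable]: "f \<in> borel_measurable borel"
    unfolding f_def by measurable
  have \<alpha>0: "\<alpha> > 0"
    using \<alpha> by (meson of_nat_0_le_iff le_less_trans)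
  have \<delta>: "0 < \<delta>" "\<delta> < 1"
    using \<alpha> \<alpha>0 by (simp_all add: \<delta>_def)
  have f0: "0 < f x" "f x \<le> 1" for x
    using b by (auto simp: f_def divide_simps add_pos_nonneg)
  have level: "{x. u < f x} = ball 0 ((b * ((1 - u) / u)) powr (1 / \<alpha>))" if u: "0 < u" "u < 1" for u
  proof -
    define r where "r = (b * ((1 - u) / u)) powr (1 / \<alpha>)"
    have r: "r \<ge> 0" "b * ((1 - u) / u) = r powr \<alpha>"
      using u b \<alpha>0 by (simp_all add: r_def powr_powr)
    have "u < f x \<longleftrightarrow> norm x < r" for x
    proof -
      have pos: "0 < b + norm x powr \<alpha>"
        using b by (simp add: add_pos_nonneg)
      have "u < f x \<longleftrightarrow> u * (b + norm x powr \<alpha>) < b"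
        using pos by (simp add: f_def pos_less_divide_eq)
      also have "\<dots> \<longleftrightarrow> norm x powr \<alpha> < b * ((1 - u) / u)"
        using u by (simp add: field_simps)
      also have "\<dots> \<longleftrightarrow> norm x < r"
        unfolding r(2)
        using \<alpha>0 r(1) powr_less_mono2[of \<alpha> "norm x" r] powr_mono2[of \<alpha> r "norm x"]
        by (meson norm_ge_zero less_imp_le not_le)
      finally show ?thesis .
    qed
    then show ?thesis
      unfolding r_def by (simp add: ball_def)
  qed
  have "(\<integral>\<^sup>+ x. ennreal (f x) \<partial>lborel) =
      (\<integral>\<^sup>+ x. (\<integral>\<^sup>+ u. indicator {0<..<1} u * indicator {x. u < f x} x \<partial>lborel) \<partial>lborel)"
  proof (rule nn_integral_cong)
    fix x
    have "(\<integral>\<^sup>+ u. indicator {0<..<1} u * indicator {x. u < f x} x \<partial>lborel) =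
        (\<integral>\<^sup>+ u. indicator {0<..<f x} u \<partial>lborel)"
      using f0[of x] by (intro nn_integral_cong) (auto simp: indicator_def)
    then show "ennreal (f x) = (\<integral>\<^sup>+ u. indicator {0<..<1} u * indicator {x. u < f x} x \<partial>lborel)"
      using f0[of x] by simp
  qed
  also have "\<dots> = (\<integral>\<^sup>+ u. (\<integral>\<^sup>+ x. indicator {0<..<1} u * indicator {x. u < f x} x \<partial>lborel) \<partial>lborel)"
    by (intro lborel_pair.Fubini') (simp add: case_prod_beta')
  \<comment> \<open>The ball has volume \<open>c * b powr \<delta>\<close> times ((1 - u) /
    u)^\<delta>, which is the Beta integrand with parameters 1 - \<delta> and 1 + \<delta>; it is
    integrable at u = 0 because \<delta> < 1. The endpoints 0 and 1 form a null set.\<close>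
  also have "\<dots> = (\<integral>\<^sup>+ u. ennreal (c * b powr \<delta>) *
      ennreal (u powr ((1 - \<delta>) - 1) * (1 - u) powr ((1 + \<delta>) - 1) * indicator {0..1} u) \<partial>lborel)"
  proof (rule nn_integral_cong_AE)
    have "AE u in lborel. u \<noteq> (0::real) \<and> u \<noteq> 1"
      by (intro AE_conjI AE_lborel_singleton)
    then show "AE u in lborel. (\<integral>\<^sup>+ x. indicator {0<..<1} u * indicator {x. u < f x} x \<partial>lborel) =
      ennreal (c * b powr \<delta>) *
      ennreal (u powr ((1 - \<delta>) - 1) * (1 - u) powr ((1 + \<delta>) - 1) * indicator {0..1} u)"
    proof eventually_elim
      case (elim u)
      show ?case
      proof (cases "0 < u \<and> u < 1")
        case True
        then have "(\<integral>\<^sup>+ x. indicator {0<..<1} u * indicator {x. u < f x} x \<partial>lborel) =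
            emeasure lborel {x. u < f x}"
          by simp
        also have "\<dots> = ennreal (c * (b * ((1 - u) / u)) powr \<delta>)"
          using True b \<alpha>0 by (simp add: level emeasure_lborel_ball_powr c_def \<delta>_def)
        also have "(b * ((1 - u) / u)) powr \<delta> = b powr \<delta> * (u powr (- \<delta>) * (1 - u) powr \<delta>)"
          using True b by (simp add: powr_mult powr_divide powr_minus_divide)
        finally show ?thesis
          using True by (simp add: ennreal_mult[symmetric] c_def mult.assoc)
      next
        case False
        with elim show ?thesis by (auto simp: indicator_def)
      qed
    qed
  qed
  also have "\<dots> = ennreal (c * b powr \<delta>) * ennreal (Beta (1 - \<delta>) (1 + \<delta>))"
  proof -
    have "(\<integral>\<^sup>+ u. ennreal (u powr ((1 - \<delta>) - 1) * (1 - u) powr ((1 + \<delta>) - 1) * indicator {0..1} u)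
        \<partial>lborel) = ennreal (Beta (1 - \<delta>) (1 + \<delta>))"
      using has_integral_Beta_real[of "1 - \<delta>" "1 + \<delta>"] \<delta>
      by (subst nn_integral_has_integral_lebesgue[symmetric, where \<Omega>="{0..1}" and
            f="\<lambda>u. u powr ((1 - \<delta>) - 1) * (1 - u) powr ((1 + \<delta>) - 1)"])
         (auto simp: mult.commute)
    then show ?thesis
      by (subst nn_integral_cmult) simp_all
  qed
  \<comment> \<open>The parameters add up to 2, and \<Gamma>(2) = 1 removes the denominator of the
    Beta function.\<close>
  also have "\<dots> = ennreal (c * b powr \<delta> * (Gamma (1 + \<delta>) * Gamma (1 - \<delta>)))"
    using \<delta> by (subst ennreal_mult[symmetric]) (simp_all add: Beta_def c_def Gamma_numeral mult_ac)
  finally show ?thesis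
    by (simp add: f_def c_def)
qed

text \<open>The singularity at the origin is too strong: a ball of radius R alone contributes at
  least a constant times R^(d - \<alpha>), which is unbounded as R tends to 0 because \<alpha> >
  d.\<close>

lemma nn_integral_radial_infinite:
  fixes \<alpha> t :: real
  assumes \<alpha>: "\<alpha> > real DIM('a::euclidean_space)" and t: "t > 0"
  shows "(\<integral>\<^sup>+ x. ennreal (t * norm (x::'a) powr (- \<alpha>)) \<partial>lborel) = \<infinity>"
proof -
  define c where "c = measure lborel (ball (0::'a) 1)"
  have c: "c > 0"
    by (simp add: c_def content_ball unit_ball_vol_pos)
  have bound: "ennreal (t * c * (1 / R) powr (\<alpha> - DIM('a))) \<le>
      (\<integral>\<^sup>+ x. ennreal (t * norm (x::'a) powr (- \<alpha>)) \<partial>lborel)" if R: "R > 0" for R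
  proof -
    have "ennreal (t * c * (1 / R) powr (\<alpha> - DIM('a))) =
        ennreal (t * R powr (- \<alpha>)) * emeasure lborel (ball (0::'a) R)"
      using R t by (simp add: emeasure_ball content_ball c_def ennreal_mult[symmetric] powr_diff
          powr_minus powr_realpow field_simps powr_divide)
    also have "\<dots> = (\<integral>\<^sup>+ x. ennreal (t * R powr (- \<alpha>)) * indicator (ball (0::'a) R) x \<partial>lborel)"
      by (simp add: nn_integral_cmult_indicator)
    also have "\<dots> \<le> (\<integral>\<^sup>+ x. ennreal (t * norm (x::'a) powr (- \<alpha>)) \<partial>lborel)"
    proof (rule nn_integral_mono_AE)
      \<comment> \<open>The origin is removed because \<open>0 powr (- \<alpha>)\<close> is 0, which
        would violate the bound there.\<close>
      show "AE x in lborel. ennreal (t * R powr (- \<alpha>)) * indicator (ball (0::'a) R) x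
          \<le> ennreal (t * norm (x::'a) powr (- \<alpha>))"
        using AE_lborel_singleton[of "0::'a"]
      proof eventually_elim
        case (elim x)
        have "R powr (- \<alpha>) \<le> norm x powr (- \<alpha>)" if "norm x < R"
          using that elim \<alpha> by (intro powr_mono2') auto
        then show ?case
          using t by (auto simp: indicator_def intro!: ennreal_leI)
      qed
    qed
    finally show ?thesis .
  qed
  \<comment> \<open>The radius (n + 1)^(-1 / (\<alpha> - d)) is chosen so that the lower bound grows
    linearly in n.\<close>
  have bound': "ennreal (t * c * real (Suc n)) \<le>
      (\<integral>\<^sup>+ x. ennreal (t * norm (x::'a) powr (- \<alpha>)) \<partial>lborel)" for n
    using bound[of "real (Suc n) powr (- (1 / (\<alpha> - DIM('a))))"] \<alpha>
    by (simp add: powr_minus_divide powr_powr del: of_nat_Suc)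
  have "filterlim (\<lambda>n. t * c * real (Suc n)) at_top sequentially"
    using t c by (intro filterlim_tendsto_pos_mult_at_top[OF tendsto_const]
        filterlim_compose[OF filterlim_real_sequentially filterlim_Suc]) simp
  then have lim: "(\<lambda>n. ennreal (t * c * real (Suc n))) \<longlonglongrightarrow> \<infinity>"
    by (simp add: ennreal_tendsto_top_eq_at_top)
  have "\<infinity> \<le> (\<integral>\<^sup>+ x. ennreal (t * norm (x::'a) powr (- \<alpha>)) \<partial>lborel)"
    using bound' by (intro LIMSEQ_le_const2[OF lim]) auto
  then show ?thesis
    by (simp add: top_unique)
qed

section \<open>The probability generating functional of a Poisson process\<close>

text \<open>Splitting by the value of \<open>Z\<close> produces the exponential series of
  \<open>c * r\<close>. The generating function is needed beyond the unit interval, at arguments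
  \<open>c > 1\<close>.\<close>

lemma (in prob_space) nn_integral_power_poisson:
  assumes Z[measurable]: "Z \<in> measurable M (count_space UNIV)"
    and pois: "\<And>k::nat. prob {\<omega> \<in> space M. Z \<omega> = k} = r ^ k / fact k * exp (- r)"
    and r: "0 \<le> r" and c: "0 \<le> c"
  shows "(\<integral>\<^sup>+ \<omega>. ennreal (c ^ Z \<omega>) \<partial>M) = ennreal (exp (r * (c - 1)))"
proof -
  have "(\<integral>\<^sup>+ \<omega>. ennreal (c ^ Z \<omega>) \<partial>M) =
      (\<integral>\<^sup>+ \<omega>. (\<Sum>k. ennreal (c ^ k) * indicator {\<omega> \<in> space M. Z \<omega> = k} \<omega>) \<partial>M)"
  proof (rule nn_integral_cong)
    fix \<omega> assume "\<omega> \<in> space M"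
    then have "(\<lambda>k. ennreal (c ^ k) * indicator {\<omega> \<in> space M. Z \<omega> = k} \<omega>) =
        (\<lambda>k. if k = Z \<omega> then ennreal (c ^ k) else 0)"
      by (auto simp: indicator_def)
    then show "ennreal (c ^ Z \<omega>) = (\<Sum>k. ennreal (c ^ k) * indicator {\<omega> \<in> space M. Z \<omega> = k} \<omega>)"
      using sums_unique[OF sums_single[of "Z \<omega>" "\<lambda>k. ennreal (c ^ k)"]] by simp
  qed
  also have "\<dots> = (\<Sum>k. ennreal (c ^ k) * emeasure M {\<omega> \<in> space M. Z \<omega> = k})"
    by (subst nn_integral_suminf) (simp_all add: nn_integral_cmult_indicator)
  also have "\<dots> = (\<Sum>k. ennreal ((c * r) ^ k / fact k * exp (- r)))"
    using r c by (simp add: emeasure_eq_measure pois ennreal_mult[symmetric] power_mult_distrib mult_ac)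
  also have "\<dots> = ennreal (exp (c * r) * exp (- r))"
  proof (rule sums_unique[symmetric])
    have "(\<lambda>k. (c * r) ^ k / fact k * exp (- r)) sums (exp (c * r) * exp (- r))"
      using exp_converges[of "c * r"] by (intro sums_mult2) (simp add: divide_inverse mult.commute)
    then show "(\<lambda>k. ennreal ((c * r) ^ k / fact k * exp (- r))) sums ennreal (exp (c * r) * exp (- r))"
      using r c by simp
  qed
  finally show ?thesis
    by (simp add: exp_add[symmetric] algebra_simps)
qed

text \<open>The values are numbered by \<open>e\<close> so that the level sets become a family
  indexed by \<open>{..<n}\<close>, the shape in which a Poisson process provides independent
  counts. The value 0 is left out: it contributes nothing, and in the application its level set is
  unbounded.\<close>

lemma nn_integral_eq_sum_level_sets:
  fixes V :: "'a \<Rightarrow> real"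
  assumes [measurable]: "V \<in> borel_measurable M" and fin: "finite (range V)" and nn: "\<And>x. 0 \<le> V x"
    and e: "bij_betw e {..<n} (range V - {0})"
  shows "(\<integral>\<^sup>+ x. ennreal (V x) \<partial>M) = (\<Sum>j<n. ennreal (e j) * emeasure M (V -` {e j} \<inter> space M))"
proof -
  have "(\<integral>\<^sup>+ x. ennreal (V x) \<partial>M) =
      (\<integral>\<^sup>+ x. (\<Sum>j<n. ennreal (e j) * indicator (V -` {e j} \<inter> space M) x) \<partial>M)"
  proof (rule nn_integral_cong)
    fix x assume x: "x \<in> space M"
    have "(\<Sum>j<n. ennreal (e j) * indicator (V -` {e j} \<inter> space M) x) =
        (\<Sum>y\<in>range V - {0}. ennreal y * indicator (V -` {y} \<inter> space M) x)"
      using e by (rule sum.reindex_bij_betw)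
    also have "\<dots> = (\<Sum>y\<in>range V - {0}. if y = V x then ennreal (V x) else 0)"
      using x by (intro sum.cong) (auto simp: indicator_def)
    also have "\<dots> = ennreal (V x)"
      using fin by (simp add: sum.delta)
    finally show "ennreal (V x) = (\<Sum>j<n. ennreal (e j) * indicator (V -` {e j} \<inter> space M) x)" ..
  qed
  also have "\<dots> = (\<Sum>j<n. ennreal (e j) * emeasure M (V -` {e j} \<inter> space M))"
    by (subst nn_integral_sum) (auto simp: nn_integral_cmult_indicator)
  finally show ?thesis .
qed

text \<open>For a step function, the product over the points is a product of powers of the counts of
  disjoint sets, which are independent Poisson variables.\<close>
lemma (in prob_space) poisson_pgfl_step:
  fixes X :: "nat \<Rightarrow> 'a \<Rightarrow> 'b::euclidean_space" and V :: "'b \<Rightarrow> real"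
  assumes PPP: "poisson_point_process M lam X" and lam: "0 \<le> lam"
    and V[measurable]: "V \<in> borel_measurable borel" and fin: "finite (range V)" and nn: "\<And>x. 0 \<le> V x"
    and bdd: "bounded {x. V x \<noteq> 0}"
  obtains I where "0 \<le> I" "(\<integral>\<^sup>+ x. ennreal (V x) \<partial>lborel) = ennreal I"
    "(\<integral>\<^sup>+ \<omega>. (SUP m. ennreal (\<Prod>i<m. 1 + V (X i \<omega>))) \<partial>M) = ennreal (exp (lam * I))"
proof -
  obtain e n where e: "bij_betw e {..<n::nat} (range V - {0})"
    using ex_bij_betw_nat_finite[of "range V - {0}"] fin by (auto simp: atLeast0LessThan)
  have e0: "e j > 0" if "j < n" for j
  proof -
    have "e j \<in> range V - {0}"
      using bij_betwE[OF e] that by simp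
    then show ?thesis
      using nn by (force simp: less_le)
  qed
  define B where "B j = V -` {e j}" for j
  have B: "B j \<in> sets borel" "bounded (B j)" if "j < n" for j
  proof -
    show "B j \<in> sets borel"
      using measurable_sets[OF V, of "{e j}"] by (simp add: B_def)
    show "bounded (B j)"
      using e0[OF that] by (intro bounded_subset[OF bdd]) (auto simp: B_def)
  qed
  have disj: "disjoint_family_on B {..<n}"
    using e by (auto simp: disjoint_family_on_def B_def bij_betw_def inj_on_def)
  have fin_B: "emeasure lborel (B j) = ennreal (measure lborel (B j))" if "j < n" for j
    using emeasure_bounded_finite[OF B(2)[OF that]] by (simp add: emeasure_eq_ennreal_measure less_top)
  \<comment> \<open>The level sets are disjoint, so at most one factor differs from 1. Exchanging
    this product with the one over the points collects equal factors into powers.\<close>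
  have V_prod: "1 + V x = (\<Prod>j<n. if x \<in> B j then 1 + e j else 1)" for x
  proof -
    have "(\<Prod>j<n. if x \<in> B j then 1 + e j else 1) = (\<Prod>y\<in>range V - {0}. if V x = y then 1 + y else 1)"
      unfolding B_def by (subst prod.reindex_bij_betw[OF e, symmetric]) (auto intro!: prod.cong)
    also have "\<dots> = 1 + V x"
      using fin by (simp add: prod.delta')
    finally show ?thesis ..
  qed
  define I where "I = (\<Sum>j<n. e j * measure lborel (B j))"
  have I0: "I \<ge> 0"
    unfolding I_def using e0 by (intro sum_nonneg mult_nonneg_nonneg) (auto simp: less_imp_le)
  have int: "(\<integral>\<^sup>+ x. ennreal (V x) \<partial>lborel) = ennreal I"
    using e0 by (subst nn_integral_eq_sum_level_sets[OF _ fin nn e])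
      (auto simp: I_def fin_B[unfolded B_def] B_def ennreal_mult'[symmetric] less_imp_le intro!: sum_ennreal)
  have PPP': "AE \<omega> in M. finite {i. X i \<omega> \<in> B j}"
    "prob {\<omega> \<in> space M. ppp_count X (B j) \<omega> = k} =
              (lam * measure lborel (B j)) ^ k / fact k * exp (- (lam * measure lborel (B j)))" if "j < n" for j k
    using PPP B[OF that] unfolding poisson_point_process_def by blast+
  have ind: "indep_vars (\<lambda>_. count_space UNIV) (\<lambda>j. ppp_count X (B j)) {..<n}"
    using PPP[unfolded poisson_point_process_def, THEN conjunct2, THEN conjunct2, THEN conjunct2,
        rule_format, of n B] B disj by simp
  have "AE \<omega> in M. \<forall>j\<in>{..<n}. finite {i. X i \<omega> \<in> B j}"
    using PPP' by (intro AE_finite_allI) auto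
  then have "(\<integral>\<^sup>+ \<omega>. (SUP m. ennreal (\<Prod>i<m. 1 + V (X i \<omega>))) \<partial>M) =
      (\<integral>\<^sup>+ \<omega>. (\<Prod>j<n. ennreal ((1 + e j) ^ ppp_count X (B j) \<omega>)) \<partial>M)"
  proof (intro nn_integral_cong_AE, eventually_elim)
    case (elim \<omega>)
    define P where "P m = (\<Prod>i<m. 1 + V (X i \<omega>))" for m
    have P: "P m = (\<Prod>j<n. (1 + e j) ^ card {i. i < m \<and> X i \<omega> \<in> B j})" for m
    proof -
      have "P m = (\<Prod>j<n. \<Prod>i<m. if X i \<omega> \<in> B j then 1 + e j else 1)"
        unfolding P_def V_prod by (rule prod.swap)
      moreover have "(\<Prod>i<m. if X i \<omega> \<in> B j then 1 + e j else 1) =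
          (1 + e j) ^ card {i. i < m \<and> X i \<omega> \<in> B j}" for j
        by (subst prod.inter_filter[symmetric]) auto
      ultimately show ?thesis
        by simp
    qed
    \<comment> \<open>Almost surely only finitely many points fall into the bounded support, so the
      partial products are constant from \<open>m0\<close> on.\<close>
    obtain m0 where m0: "(\<Union>j<n. {i. X i \<omega> \<in> B j}) \<subseteq> {..<m0}"
      using elim finite_nat_iff_bounded[of "\<Union>j<n. {i. X i \<omega> \<in> B j}"] by auto
    have "P m = (\<Prod>j<n. (1 + e j) ^ ppp_count X (B j) \<omega>)" if "m \<ge> m0" for m
    proof -
      have "{i. i < m \<and> X i \<omega> \<in> B j} = {i. X i \<omega> \<in> B j}" if "j < n" for j
        using m0 \<open>m \<ge> m0\<close> that by (auto simp: subset_iff intro: less_le_trans)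
      then show ?thesis by (simp add: P ppp_count_def)
    qed
    then have "P \<longlonglongrightarrow> (\<Prod>j<n. (1 + e j) ^ ppp_count X (B j) \<omega>)"
      by (intro tendsto_eventually) (auto simp: eventually_sequentially)
    then have "(\<lambda>m. ennreal (P m)) \<longlonglongrightarrow> ennreal (\<Prod>j<n. (1 + e j) ^ ppp_count X (B j) \<omega>)"
      by (rule tendsto_ennrealI)
    moreover have "incseq (\<lambda>m. ennreal (P m))"
    proof (rule incseq_SucI)
      fix m
      have "P m \<ge> 0" unfolding P_def using nn by (intro prod_nonneg) (auto intro: add_nonneg_nonneg)
      then have "P m * 1 \<le> P m * (1 + V (X m \<omega>))" using nn by (intro mult_left_mono) auto
      then show "ennreal (P m) \<le> ennreal (P (Suc m))"
        by (intro ennreal_leI) (simp add: P_def)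
    qed
    ultimately have "(SUP m. ennreal (P m)) = ennreal (\<Prod>j<n. (1 + e j) ^ ppp_count X (B j) \<omega>)"
      using LIMSEQ_SUP LIMSEQ_unique by blast
    moreover have "ennreal (\<Prod>j<n. (1 + e j) ^ ppp_count X (B j) \<omega>) =
        (\<Prod>j<n. ennreal ((1 + e j) ^ ppp_count X (B j) \<omega>))"
      using e0 by (intro prod_ennreal[symmetric] zero_le_power add_nonneg_nonneg) (auto intro: less_imp_le)
    ultimately show ?case by (simp add: P_def)
  qed
  also have "\<dots> = (\<Prod>j<n. \<integral>\<^sup>+ \<omega>. ennreal ((1 + e j) ^ ppp_count X (B j) \<omega>) \<partial>M)"
    by (intro indep_vars_nn_integral indep_vars_compose2[OF ind, of "\<lambda>j k. ennreal ((1 + e j) ^ k)"]) auto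
  also have "\<dots> = (\<Prod>j<n. ennreal (exp (lam * measure lborel (B j) * ((1 + e j) - 1))))"
  proof (intro prod.cong refl nn_integral_power_poisson)
    fix j assume "j \<in> {..<n}"
    then have j: "j < n" by simp
    show "ppp_count X (B j) \<in> measurable M (count_space UNIV)"
      using ind j by (auto simp: indep_vars_def)
    show "prob {\<omega> \<in> space M. ppp_count X (B j) \<omega> = k} =
              (lam * measure lborel (B j)) ^ k / fact k * exp (- (lam * measure lborel (B j)))" for k
      by (rule PPP'(2)[OF j])
    show "0 \<le> 1 + e j" using e0[OF j] by simp
  qed (use lam in simp)
  also have "\<dots> = ennreal (exp (lam * I))"
    by (simp add: prod_ennreal exp_sum I_def sum_distrib_left mult_ac)
  finally show thesis
    using that I0 int by blast
qed

text \<open>Step functions with bounded support increase to \<open>u\<close>, and monotone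
  convergence carries their identity to the limit on both sides. Since \<open>lam > 0\<close>, an
  infinite integral of \<open>u\<close> makes the expectation infinite.\<close>

lemma (in prob_space) poisson_pgfl:
  fixes X :: "nat \<Rightarrow> 'a \<Rightarrow> 'b::euclidean_space" and u :: "'b \<Rightarrow> real"
  assumes PPP: "poisson_point_process M lam X" and lam: "0 < lam"
    and u[measurable]: "u \<in> borel_measurable borel" and nn: "\<And>x. 0 \<le> u x"
  defines "J \<equiv> \<integral>\<^sup>+ x. ennreal (u x) \<partial>lborel"
  shows "(\<integral>\<^sup>+ \<omega>. (SUP m. ennreal (\<Prod>i<m. 1 + u (X i \<omega>))) \<partial>M) =
    (if J = \<infinity> then \<infinity> else ennreal (exp (lam * enn2real J)))"
proof -
  have X[measurable]: "X i \<in> borel_measurable M" for i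
    using PPP by (simp add: poisson_point_process_def)
  obtain U :: "nat \<Rightarrow> 'b \<Rightarrow> ennreal" where U: "\<And>i. simple_function borel (U i)" "incseq U"
      "\<And>i x. U i x < top" "\<And>x. (SUP i. U i x) = ennreal (u x)"
    using borel_measurable_implies_simple_function_sequence'[of "\<lambda>x. ennreal (u x)" borel] by auto
  \<comment> \<open>Cutting off outside a growing ball supplies the bounded support that the
    step-function case requires; the values of \<open>U n\<close> are finite, so
    \<open>enn2real\<close> loses nothing.\<close>
  define V where "V n x = enn2real (U n x) * indicator (ball 0 (real n)) x" for n x
  have [measurable]: "U n \<in> borel_measurable borel" for n
    using U(1) by (rule borel_measurable_simple_function)
  have V_meas[measurable]: "V n \<in> borel_measurable borel" for n
    unfolding V_def by (intro borel_measurable_times borel_measurable_indicator) auto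
  have V0: "V n x \<ge> 0" for n x by (simp add: V_def)
  have V_fin: "finite (range (V n))" for n
  proof (rule finite_subset)
    show "range (V n) \<subseteq> insert 0 (enn2real ` range (U n))"
      by (auto simp: V_def indicator_def)
    show "finite (insert 0 (enn2real ` range (U n)))"
      using U(1)[of n] by (simp add: simple_function_def)
  qed
  have V_bdd: "bounded {x. V n x \<noteq> 0}" for n
    by (rule bounded_subset[OF bounded_ball[of 0 "real n"]]) (auto simp: V_def indicator_def)
  have V_mono: "V m x \<le> V n x" if "m \<le> n" for m n x
  proof -
    have "enn2real (U m x) \<le> enn2real (U n x)"
      using U(2,3) that by (intro enn2real_mono) (auto simp: incseq_def le_fun_def)
    then show ?thesis
      using that by (auto simp: V_def indicator_def)
  qed
  have V_lim: "(\<lambda>n. V n x) \<longlonglongrightarrow> u x" for x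
  proof -
    have "(\<lambda>n. U n x) \<longlonglongrightarrow> ennreal (u x)"
      using U(2) by (subst U(4)[symmetric], intro LIMSEQ_SUP) (auto simp: incseq_def le_fun_def)
    then have "(\<lambda>n. enn2real (U n x)) \<longlonglongrightarrow> u x"
      using nn by (rule tendsto_enn2real)
    moreover obtain n0 where n0: "norm x < real n0"
      using reals_Archimedean2 by blast
    have "eventually (\<lambda>n. enn2real (U n x) = V n x) sequentially"
      using eventually_ge_at_top[of n0] by eventually_elim (use n0 in \<open>auto simp: V_def indicator_def\<close>)
    ultimately show ?thesis
      by (rule Lim_transform_eventually)
  qed
  have "\<exists>I. 0 \<le> I \<and> (\<integral>\<^sup>+ x. ennreal (V n x) \<partial>lborel) = ennreal I \<and>
    (\<integral>\<^sup>+ \<omega>. (SUP m. ennreal (\<Prod>i<m. 1 + V n (X i \<omega>))) \<partial>M) = ennreal (exp (lam * I))" for n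
    by (rule poisson_pgfl_step[OF PPP less_imp_le[OF lam] V_meas V_fin V0 V_bdd]) blast
  then obtain I where I: "\<And>n. 0 \<le> I n" "\<And>n. (\<integral>\<^sup>+ x. ennreal (V n x) \<partial>lborel) = ennreal (I n)"
      "\<And>n. (\<integral>\<^sup>+ \<omega>. (SUP m. ennreal (\<Prod>i<m. 1 + V n (X i \<omega>))) \<partial>M) = ennreal (exp (lam * I n))"
    by metis
  have mono_prod: "ennreal (\<Prod>i<m. 1 + V n (X i \<omega>)) \<le> ennreal (\<Prod>i<m'. 1 + V n' (X i \<omega>))"
    if "m \<le> m'" "n \<le> n'" for m m' n n' \<omega>
  proof -
    have "(\<Prod>i<m. 1 + V n (X i \<omega>)) \<le> (\<Prod>i<m. 1 + V n' (X i \<omega>))"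
      using V_mono[OF that(2)] V0 by (intro prod_mono) (auto intro: add_nonneg_nonneg)
    also have "\<dots> \<le> (\<Prod>i<m'. 1 + V n' (X i \<omega>))"
      using that(1) V0 by (intro prod_mono2) (auto intro!: add_nonneg_nonneg)
    finally show ?thesis
      by (rule ennreal_leI)
  qed
  have "(\<integral>\<^sup>+ \<omega>. (SUP m. ennreal (\<Prod>i<m. 1 + u (X i \<omega>))) \<partial>M) =
      (\<integral>\<^sup>+ \<omega>. (SUP m. SUP n. ennreal (\<Prod>i<m. 1 + V n (X i \<omega>))) \<partial>M)"
  proof (intro nn_integral_cong SUP_cong refl)
    fix \<omega> m
    have "(\<lambda>n. ennreal (\<Prod>i<m. 1 + V n (X i \<omega>))) \<longlonglongrightarrow> ennreal (\<Prod>i<m. 1 + u (X i \<omega>))"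
      by (intro tendsto_intros V_lim)
    moreover have "(\<lambda>n. ennreal (\<Prod>i<m. 1 + V n (X i \<omega>))) \<longlonglongrightarrow> (SUP n. ennreal (\<Prod>i<m. 1 + V n (X i \<omega>)))"
      by (intro LIMSEQ_SUP) (auto simp: incseq_def intro!: mono_prod)
    ultimately show "ennreal (\<Prod>i<m. 1 + u (X i \<omega>)) = (SUP n. ennreal (\<Prod>i<m. 1 + V n (X i \<omega>)))"
      by (rule LIMSEQ_unique)
  qed
  \<comment> \<open>The partial products increase in both indices, so the suprema commute; with the
    one over \<open>n\<close> outermost it can leave the integral, and each remaining integral
    concerns a step function.\<close>
  also have "\<dots> = (\<integral>\<^sup>+ \<omega>. (SUP n. SUP m. ennreal (\<Prod>i<m. 1 + V n (X i \<omega>))) \<partial>M)"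
    by (subst SUP_commute) simp
  also have "\<dots> = (SUP n. \<integral>\<^sup>+ \<omega>. (SUP m. ennreal (\<Prod>i<m. 1 + V n (X i \<omega>))) \<partial>M)"
    by (intro nn_integral_monotone_convergence_SUP)
      (auto simp: incseq_def le_fun_def intro!: SUP_mono' mono_prod)
  also have "\<dots> = (SUP n. ennreal (exp (lam * I n)))"
    by (simp add: I(3))
  finally have eq: "(\<integral>\<^sup>+ \<omega>. (SUP m. ennreal (\<Prod>i<m. 1 + u (X i \<omega>))) \<partial>M) = (SUP n. ennreal (exp (lam * I n)))" .
  have I_mono: "I m \<le> I n" if "m \<le> n" for m n
  proof -
    have "ennreal (I m) \<le> ennreal (I n)"
      unfolding I(2)[symmetric] by (intro nn_integral_mono ennreal_leI V_mono that)
    then show ?thesis using I(1) by simp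
  qed
  have lim: "(\<lambda>n. ennreal (exp (lam * I n))) \<longlonglongrightarrow> (SUP n. ennreal (exp (lam * I n)))"
    using lam by (intro LIMSEQ_SUP) (auto simp: incseq_def intro!: ennreal_leI I_mono)
  have I_lim: "(\<lambda>n. ennreal (I n)) \<longlonglongrightarrow> J"
    unfolding I(2)[symmetric] J_def
    by (intro nn_integral_LIMSEQ) (auto simp: incseq_def le_fun_def intro!: ennreal_leI V_mono tendsto_ennrealI V_lim)
  show ?thesis
  proof (cases "J = \<infinity>")
    case True
    then have "filterlim I at_top sequentially"
      using I_lim by (simp add: ennreal_tendsto_top_eq_at_top)
    then have "filterlim (\<lambda>n. exp (lam * I n)) at_top sequentially"
      using lam by (intro filterlim_compose[OF exp_at_top] filterlim_tendsto_pos_mult_at_top[OF tendsto_const])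
    then have "(\<lambda>n. ennreal (exp (lam * I n))) \<longlonglongrightarrow> \<infinity>"
      by (simp add: ennreal_tendsto_top_eq_at_top)
    from LIMSEQ_unique[OF lim this] True eq show ?thesis
      by simp
  next
    case False
    then have "J = ennreal (enn2real J)" by (simp add: less_top)
    then have "I \<longlonglongrightarrow> enn2real J"
      using I_lim I(1) tendsto_ennreal_iff[of I sequentially "enn2real J"] by auto
    then have "(\<lambda>n. ennreal (exp (lam * I n))) \<longlonglongrightarrow> ennreal (exp (lam * enn2real J))"
      by (intro tendsto_intros)
    from LIMSEQ_unique[OF lim this] False eq show ?thesis
      by simp
  qed
qed

section \<open>Waiting times for independent trials\<close>

lemma suminf_one_ennreal: "(\<Sum>n::nat. 1 :: ennreal) = \<top>"
  using nn_integral_count_space_nat[of "\<lambda>_. 1"] by (simp add: emeasure_count_space_infinite)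

text \<open>A waiting time T is the number of n with n < T, and n < T means that the first n slots,
  numbered from 0, contain fewer than \<open>N\<close> successes. If the goal is never reached,
  every summand is 1 and the series is infinite.\<close>

lemma local_delay_eq_suminf:
  "local_delay succ N \<omega> = (\<Sum>n. if card {k. k < n \<and> succ k \<omega>} < N then 1 else 0)"
proof -
  define c where "c n = card {k. k < n \<and> succ k \<omega>}" for n
  have c_mono: "c m \<le> c n" if "m \<le> n" for m n
    unfolding c_def using that by (intro card_mono) auto
  show ?thesis
  proof (cases "\<exists>n. N \<le> c n")
    case True
    define L where "L = (LEAST n. N \<le> c n)"
    have "N \<le> c L"
      unfolding L_def using True by (rule LeastI_ex)
    then have "c n < N \<longleftrightarrow> n < L" for n
      using c_mono[of L n] not_less_Least[of n "\<lambda>n. N \<le> c n", folded L_def] by (meson leD leI le_trans)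
    then have "(\<Sum>n. if c n < N then 1 else 0) = (\<Sum>n<L. 1 :: ennreal)"
      by (subst suminf_finite[of "{..<L}"]) auto
    then show ?thesis
      using True by (simp add: local_delay_def L_def c_def ennreal_of_nat_eq_real_of_nat)
  next
    case False
    then have "(\<Sum>n. if c n < N then 1 else 0) = (\<Sum>n. 1 :: ennreal)"
      by (simp add: not_le)
    also have "\<dots> = \<infinity>"
      by (simp add: suminf_one_ennreal)
    finally show ?thesis
      using False by (simp add: local_delay_def c_def)
  qed
qed

lemma measurable_local_delay:
  assumes "\<And>k. Measurable.pred M (succ k)"
  shows "local_delay succ N \<in> borel_measurable M"
proof -
  note assms[measurable]
  have "local_delay succ N = (\<lambda>\<omega>. \<Sum>n. if card {k. k < n \<and> succ k \<omega>} < N then 1 else 0)"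
    by (simp add: fun_eq_iff local_delay_eq_suminf)
  then show ?thesis by simp
qed

text \<open>The expectation is the sum of the tail probabilities \<open>a n N\<close> that fewer than \<open>N\<close>
  successes occur in \<open>n\<close> trials, which satisfy
  \<open>a (n + 1) (N + 1) = p * a n N + (1 - p) * a n (N + 1)\<close>.\<close>
lemma (in prob_space) nn_integral_local_delay_iid:
  assumes ind: "indep_vars (\<lambda>_. count_space UNIV) succ UNIV"
    and p: "\<And>k::nat. prob {\<omega> \<in> space M. succ k \<omega>} = p"
  shows "(\<integral>\<^sup>+ \<omega>. local_delay succ N \<omega> \<partial>M) = ennreal (real N) / ennreal p"
proof -
  have [measurable]: "Measurable.pred M (succ k)" for k
    using ind by (auto simp: indep_vars_def)
  define c where "c n \<omega> = card {k. k < n \<and> succ k \<omega>}" for n \<omega>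
  have c_meas[measurable]: "c n \<in> measurable M (count_space UNIV)" for n
    unfolding c_def by measurable
  have c_Suc: "c (Suc n) \<omega> = c n \<omega> + (if succ n \<omega> then 1 else 0)" for n \<omega>
  proof -
    have "{k. k < Suc n \<and> succ k \<omega>} = {k. k < n \<and> succ k \<omega>} \<union> (if succ n \<omega> then {n} else {})"
      by (auto simp: less_Suc_eq)
    then show ?thesis by (simp add: c_def)
  qed
  define a where "a n N = prob {\<omega> \<in> space M. c n \<omega> < N}" for n N
  have p01: "0 \<le> p" "p \<le> 1"
    using p[of 0] by (auto simp flip: p)
  have a01: "0 \<le> a n N" "a n N \<le> 1" for n N by (auto simp: a_def)
  have a_zero: "a n 0 = 0" for n by (simp add: a_def)
  have a_start: "a 0 (Suc N) = 1" for N by (simp add: a_def c_def prob_space)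
  have a_Suc: "a (Suc n) (Suc N) = p * a n N + (1 - p) * a n (Suc N)" for n N
  proof -
    \<comment> \<open>Slot \<open>n\<close> and the earlier slots are disjoint blocks of the
      independent family. The two variables need a common type, so the success of slot
      \<open>n\<close> is coded as the number 0 or 1.\<close>
    have "indep_var (count_space UNIV) ((\<lambda>f. of_bool (f n) :: nat) \<circ> (\<lambda>\<omega>. restrict (\<lambda>i. succ i \<omega>) {n}))
        (count_space UNIV) ((\<lambda>f. card {k. k < n \<and> f k}) \<circ> (\<lambda>\<omega>. restrict (\<lambda>i. succ i \<omega>) {..<n}))"
    proof (intro indep_var_compose[OF indep_var_restrict[OF ind]])
      have [measurable]: "Measurable.pred (PiM {..<n} (\<lambda>_. count_space UNIV)) (\<lambda>f. k < n \<and> f k)" for k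
        by (cases "k < n") (auto intro: measurable_component_singleton)
      show "(\<lambda>f. card {k. k < n \<and> f k}) \<in> measurable (PiM {..<n} (\<lambda>_. count_space UNIV)) (count_space UNIV)"
        by measurable
    qed auto
    also have "(\<lambda>f. of_bool (f n)) \<circ> (\<lambda>\<omega>. restrict (\<lambda>i. succ i \<omega>) {n}) = (\<lambda>\<omega>. of_bool (succ n \<omega>))"
      by auto
    also have "(\<lambda>f. card {k. k < n \<and> f k}) \<circ> (\<lambda>\<omega>. restrict (\<lambda>i. succ i \<omega>) {..<n}) = c n"
      by (auto simp: fun_eq_iff c_def intro!: arg_cong[where f=card])
    finally have indep: "indep_var (count_space UNIV) (\<lambda>\<omega>. of_bool (succ n \<omega>)) (count_space UNIV) (c n)" .
    have split: "{\<omega> \<in> space M. c (Suc n) \<omega> < Suc N} =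
        (\<lambda>x. (of_bool (succ n x) :: nat, c n x)) -` ({1} \<times> {..<N}) \<inter> space M \<union>
        (\<lambda>x. (of_bool (succ n x) :: nat, c n x)) -` ({0} \<times> {..<Suc N}) \<inter> space M"
      by (auto simp: c_Suc split: if_splits)
    have "a (Suc n) (Suc N) = prob ((\<lambda>x. (of_bool (succ n x) :: nat, c n x)) -` ({1} \<times> {..<N}) \<inter> space M) +
        prob ((\<lambda>x. (of_bool (succ n x) :: nat, c n x)) -` ({0} \<times> {..<Suc N}) \<inter> space M)"
      unfolding a_def split
    proof (rule finite_measure_Union)
      have [measurable]: "(\<lambda>x. (of_bool (succ n x) :: nat, c n x)) \<in> measurable M (count_space UNIV)"
        by measurable
      show "(\<lambda>x. (of_bool (succ n x) :: nat, c n x)) -` ({1} \<times> {..<N}) \<inter> space M \<in> events"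
        "(\<lambda>x. (of_bool (succ n x) :: nat, c n x)) -` ({0} \<times> {..<Suc N}) \<inter> space M \<in> events"
        by (auto intro: measurable_sets)
    qed auto
    also have "\<dots> = prob ((\<lambda>\<omega>. of_bool (succ n \<omega>) :: nat) -` {1} \<inter> space M) * prob (c n -` {..<N} \<inter> space M) +
        prob ((\<lambda>\<omega>. of_bool (succ n \<omega>) :: nat) -` {0} \<inter> space M) * prob (c n -` {..<Suc N} \<inter> space M)"
      by (simp only: indep_varD[OF indep] sets_count_space Pow_UNIV UNIV_I)
    also have "(\<lambda>\<omega>. of_bool (succ n \<omega>) :: nat) -` {1} \<inter> space M = {\<omega> \<in> space M. succ n \<omega>}"
      by (auto simp: of_bool_def split: if_splits)
    also have "(\<lambda>\<omega>. of_bool (succ n \<omega>) :: nat) -` {0} \<inter> space M = space M - {\<omega> \<in> space M. succ n \<omega>}" by auto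
    also have "prob (space M - {\<omega> \<in> space M. succ n \<omega>}) = 1 - p"
      by (subst prob_compl) (auto simp: p)
    moreover have "c n -` {..<K} \<inter> space M = {\<omega> \<in> space M. c n \<omega> < K}" for K by auto
    ultimately show ?thesis by (simp add: a_def p)
  qed
  have "(\<integral>\<^sup>+ \<omega>. local_delay succ N \<omega> \<partial>M) = (\<Sum>n. \<integral>\<^sup>+ \<omega>. (if c n \<omega> < N then 1 else 0) \<partial>M)"
    unfolding local_delay_eq_suminf c_def[symmetric] by (rule nn_integral_suminf) measurable
  also have "\<dots> = (\<Sum>n. ennreal (a n N))"
  proof (rule suminf_cong)
    fix n
    have "(\<integral>\<^sup>+ \<omega>. (if c n \<omega> < N then 1 else 0) \<partial>M) = (\<integral>\<^sup>+ \<omega>. indicator {\<omega> \<in> space M. c n \<omega> < N} \<omega> \<partial>M)"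
      by (intro nn_integral_cong) (auto simp: indicator_def)
    also have "\<dots> = ennreal (a n N)"
      by (simp add: a_def emeasure_eq_measure)
    finally show "(\<integral>\<^sup>+ \<omega>. (if c n \<omega> < N then 1 else 0) \<partial>M) = ennreal (a n N)" .
  qed
  also have "\<dots> = ennreal (real N) / ennreal p"
  proof (cases "p = 0")
    case True
    \<comment> \<open>Without successes all tails equal 1 and their sum diverges; for
      \<open>N = 0\<close> both sides are 0, since \<open>0 / 0\<close> is 0 in
      \<open>ennreal\<close>.\<close>
    then have "a n (Suc K) = 1" for n K
      by (induction n) (simp_all add: a_start a_Suc)
    then show ?thesis
      using True a_zero by (cases N) (simp_all add: divide_ennreal_def ennreal_mult_top suminf_one_ennreal del: of_nat_Suc)
  next
    case False
    then have p0: "p > 0" using p01 by simp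
    have "(\<lambda>n. a n K) sums (real K / p)" for K
    proof (induction K)
      case 0
      then show ?case by (simp add: a_zero)
    next
      case (Suc K)
      define S where "S m = (\<Sum>n<m. a n (Suc K))" for m
      \<comment> \<open>The recursion summed over n; the leading 1 is the tail for zero
        trials.\<close>
      have rec: "S (Suc m) = 1 + p * (\<Sum>n<m. a n K) + (1 - p) * S m" for m
        unfolding S_def sum.lessThan_Suc_shift
        by (simp add: a_start a_Suc sum.distrib sum_distrib_left)
      \<comment> \<open>Convergence has to be known before the limit of \<open>rec\<close> can be
        solved for the sum. Replacing \<open>S (Suc m)\<close> by the smaller \<open>S m\<close> in
        \<open>rec\<close> gives the bound.\<close>
      have "S m \<le> (1 + real K) / p" for m
      proof -
        have "(\<Sum>n<m. a n K) \<le> real K / p"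
          using Suc a01(1) sums_unique[OF Suc] by (metis sum_le_suminf sums_summable finite_lessThan)
        then have "p * (\<Sum>n<m. a n K) \<le> real K"
          using p0 by (simp add: field_simps)
        moreover have "S m \<le> S (Suc m)"
          using a01(1) by (simp add: S_def)
        ultimately have "p * S m \<le> 1 + real K"
          using rec[of m] by (simp add: algebra_simps)
        then show ?thesis using p0 by (simp add: field_simps)
      qed
      then have "summable (\<lambda>n. a n (Suc K))"
        using a01(1) by (intro summableI_nonneg_bounded) (auto simp: S_def)
      then obtain s where s: "(\<lambda>n. a n (Suc K)) sums s" by (auto simp: summable_def)
      then have "S \<longlonglongrightarrow> s" by (simp add: sums_def S_def[abs_def])
      then have "(\<lambda>m. S (Suc m)) \<longlonglongrightarrow> s" by (rule LIMSEQ_Suc)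
      moreover have "(\<lambda>m. S (Suc m)) \<longlonglongrightarrow> 1 + p * (real K / p) + (1 - p) * s"
        unfolding rec using Suc \<open>S \<longlonglongrightarrow> s\<close> by (intro tendsto_intros) (simp add: sums_def)
      ultimately have "s = 1 + p * (real K / p) + (1 - p) * s"
        by (rule LIMSEQ_unique)
      then have "s = real (Suc K) / p"
        using p0 by (simp add: field_simps)
      with s show ?case by simp
    qed
    then have "(\<lambda>n. ennreal (a n N)) sums ennreal (real N / p)"
      using a01(1) p0 by simp
    then show ?thesis
      using p0 by (simp add: sums_unique[symmetric] divide_ennreal)
  qed
  finally show ?thesis .
qed

section \<open>Independence and exponential variables\<close>

text \<open>Independence makes the joint law a product measure, so Fubini applies. The inner
  variable \<omega>' acts as an independent copy, and freezing \<omega> takes the place of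
  conditioning.\<close>

lemma (in prob_space) indep_var_nn_integral:
  assumes ind: "indep_var S X T Y" and f: "case_prod f \<in> borel_measurable (S \<Otimes>\<^sub>M T)"
  shows "(\<integral>\<^sup>+ \<omega>. f (X \<omega>) (Y \<omega>) \<partial>M) = (\<integral>\<^sup>+ \<omega>. \<integral>\<^sup>+ \<omega>'. f (X \<omega>) (Y \<omega>') \<partial>M \<partial>M)"
proof -
  note f[measurable]
  have [measurable]: "X \<in> measurable M S" "Y \<in> measurable M T"
    using indep_var_rv1[OF ind] indep_var_rv2[OF ind] by auto
  interpret Y: prob_space "distr M T Y" by (rule prob_space_distr) simp
  have f': "(\<lambda>y. f x y) \<in> borel_measurable T" if "x \<in> space S" for x
    using measurable_Pair2[OF f that] by simp
  have "(\<integral>\<^sup>+ \<omega>. f (X \<omega>) (Y \<omega>) \<partial>M) = (\<integral>\<^sup>+ z. case_prod f z \<partial>distr M (S \<Otimes>\<^sub>M T) (\<lambda>\<omega>. (X \<omega>, Y \<omega>)))"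
    by (subst nn_integral_distr) simp_all
  also have "\<dots> = (\<integral>\<^sup>+ z. case_prod f z \<partial>(distr M S X \<Otimes>\<^sub>M distr M T Y))"
    using ind by (simp add: indep_var_distribution_eq)
  also have "\<dots> = (\<integral>\<^sup>+ x. \<integral>\<^sup>+ y. f x y \<partial>distr M T Y \<partial>distr M S X)"
    by (subst Y.nn_integral_fst[symmetric]) simp_all
  also have "\<dots> = (\<integral>\<^sup>+ \<omega>. \<integral>\<^sup>+ y. f (X \<omega>) y \<partial>distr M T Y \<partial>M)"
    by (subst nn_integral_distr) simp_all
  also have "\<dots> = (\<integral>\<^sup>+ \<omega>. \<integral>\<^sup>+ \<omega>'. f (X \<omega>) (Y \<omega>') \<partial>M \<partial>M)"
    by (intro nn_integral_cong nn_integral_distr f' measurable_space[of X M S]) simp_all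
  finally show ?thesis .
qed

text \<open>The unit exponential density times exp(-t x) is 1 / (1 + t) times the exponential
  density of rate 1 + t. The maximum with 0 is there because \<open>h\<close> is nonnegative only
  almost surely.\<close>

lemma (in prob_space) exponential_Laplace:
  assumes D: "distributed M lborel h (exponential_density 1)" and t: "0 \<le> t"
  shows "(\<integral>\<^sup>+ \<omega>. ennreal (exp (- (t * max 0 (h \<omega>)))) \<partial>M) = ennreal (1 / (1 + t))"
proof -
  have "(\<integral>\<^sup>+ \<omega>. ennreal (exp (- (t * max 0 (h \<omega>)))) \<partial>M) =
      (\<integral>\<^sup>+ x. ennreal (exponential_density 1 x) * ennreal (exp (- (t * max 0 x))) \<partial>lborel)"
    by (rule distributed_nn_integral[OF D, symmetric]) measurable
  also have "\<dots> = (\<integral>\<^sup>+ x. ennreal (1 / (1 + t)) * ennreal (exponential_density (1 + t) x) \<partial>lborel)"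
  proof (rule nn_integral_cong)
    fix x
    have "exponential_density 1 x * exp (- (t * max 0 x)) = 1 / (1 + t) * exponential_density (1 + t) x"
    proof (cases "x < 0")
      case False
      then have "exp (- x) * exp (- (t * x)) = exp (- x * (1 + t))"
        by (simp add: exp_add[symmetric] algebra_simps)
      with False t show ?thesis
        by (simp add: exponential_density_def)
    qed (simp add: exponential_density_def)
    then show "ennreal (exponential_density 1 x) * ennreal (exp (- (t * max 0 x))) =
        ennreal (1 / (1 + t)) * ennreal (exponential_density (1 + t) x)"
      using t exponential_density_nonneg[of "1 + t" x] exponential_density_nonneg[of 1 x]
      by (simp add: ennreal_mult[symmetric])
  qed
  also have "\<dots> = ennreal (1 / (1 + t))"
    using t prob_space.emeasure_space_1[OF prob_space_exponential_density[of "1 + t"]]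
    by (subst nn_integral_cmult) (simp_all add: emeasure_density)
  finally show ?thesis .
qed

lemma local_delay_cong:
  "(\<And>k. P k \<omega> = Q k \<omega>') \<Longrightarrow> local_delay P N \<omega> = local_delay Q N \<omega>'"
  by (simp add: local_delay_def)

section \<open>Measurability and threshold form of slot success\<close>

lemma pred_eq_nat:
  assumes [measurable]: "f \<in> measurable K (count_space (UNIV :: nat set))" "g \<in> measurable K (count_space UNIV)"
  shows "Measurable.pred K (\<lambda>x. f x = g x)"
proof -
  have eq: "(\<lambda>x. f x = g x) = (\<lambda>x. \<exists>n. f x = n \<and> g x = n)"
    by auto
  show ?thesis
    unfolding eq by measurable
qed

lemma measurable_fh_interference:
  assumes "\<And>i. X i \<in> borel_measurable K" "\<And>i. h k i \<in> borel_measurable K"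
      "\<And>i. S k i \<in> measurable K (count_space UNIV)" "S0 k \<in> measurable K (count_space UNIV)"
  shows "fh_interference X h S S0 \<alpha> k \<in> borel_measurable K"
  unfolding fh_interference_def[abs_def]
proof (intro borel_measurable_suminf_order borel_measurable_times_ennreal)
  fix i
  note assms(1,2)[measurable]
  show "(\<lambda>\<omega>. ennreal (h k i \<omega> * norm (X i \<omega>) powr - \<alpha>)) \<in> borel_measurable K"
    by measurable
  have "Measurable.pred K (\<lambda>\<omega>. S k i \<omega> = S0 k \<omega>)"
    using assms by (intro pred_eq_nat)
  then show "(\<lambda>\<omega>. if S k i \<omega> = S0 k \<omega> then 1 else 0 :: ennreal) \<in> borel_measurable K"
    by (intro measurable_If) auto
qed

lemma pred_fh_success:
  assumes "\<And>i. X i \<in> borel_measurable K" "\<And>i. h k i \<in> borel_measurable K"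
      "h0 k \<in> borel_measurable K" "\<And>i. S k i \<in> measurable K (count_space UNIV)"
      "S0 k \<in> measurable K (count_space UNIV)"
  shows "Measurable.pred K (fh_success X h h0 S S0 \<alpha> r0 \<theta> N W N0 k)"
proof -
  note assms(3)[measurable]
  have [measurable]: "fh_interference X h S S0 \<alpha> k \<in> borel_measurable K"
    using assms by (intro measurable_fh_interference)
  show ?thesis
    unfolding fh_success_def[abs_def] by measurable
qed

text \<open>Multiplying by r0^\<alpha> isolates the desired fading, so that success means exceeding
  a threshold built from the other ingredients. With infinite interference both sides are
  false.\<close>

lemma fh_success_iff:
  assumes theta: "\<theta> > 0" and r0: "r0 > 0" and b: "0 \<le> W * N0"
  shows "fh_success X h h0 S S0 \<alpha> r0 \<theta> N W N0 k \<omega> \<longleftrightarrow>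
    ennreal (\<theta> * r0 powr \<alpha>) * (ennreal (W * N0 / real N) + fh_interference X h S S0 \<alpha> k \<omega>)
      < ennreal (h0 k \<omega>)"
proof (cases "fh_interference X h S S0 \<alpha> k \<omega>")
  case (real r)
  have b': "0 \<le> W * N0 / real N" using b by simp
  have "\<theta> * (W * N0 / real N + r) < h0 k \<omega> * r0 powr (- \<alpha>) \<longleftrightarrow>
      \<theta> * r0 powr \<alpha> * (W * N0 / real N + r) < h0 k \<omega>"
    using r0 by (simp add: powr_minus_divide pos_less_divide_eq mult_ac)
  then show ?thesis
    using real b' theta
    by (simp add: fh_success_def ennreal_plus[symmetric] ennreal_mult[symmetric] ennreal_less_iff
        del: ennreal_plus)
next
  case top
  then show ?thesis
    using theta r0 by (simp add: fh_success_def ennreal_mult_top)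
qed

text \<open>The tail function of a unit exponential, extended by its limit 0 to the threshold
  \<infinity>, which does occur because the interference at arbitrary fixed locations may
  diverge.\<close>

definition exp_tail :: "ennreal \<Rightarrow> real" where
  "exp_tail t = (if t = \<top> then 0 else exp (- enn2real t))"

lemma (in prob_space) emeasure_exponential_gt:
  assumes D: "distributed M lborel Z (exponential_density 1)"
  shows "emeasure M {\<omega> \<in> space M. t < ennreal (Z \<omega>)} = ennreal (exp_tail t)"
proof (cases t)
  case (real r)
  then have "{\<omega> \<in> space M. t < ennreal (Z \<omega>)} = {\<omega> \<in> space M. r < Z \<omega>}"
    by (auto simp: ennreal_less_iff)
  then show ?thesis
    using exponential_distributedD_gt[OF D, of r] real by (simp add: emeasure_eq_measure exp_tail_def)
qed (simp add: exp_tail_def)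

lemma exp_tail_tendsto:
  assumes "\<And>m. 0 \<le> t m" and lim: "(\<lambda>m. ennreal (t m)) \<longlonglongrightarrow> T"
  shows "(\<lambda>m. exp (- t m)) \<longlonglongrightarrow> exp_tail T"
proof (cases T)
  case (real r)
  then have "t \<longlonglongrightarrow> r"
    using assms by simp
  then have "(\<lambda>m. exp (- t m)) \<longlonglongrightarrow> exp (- r)"
    by (intro tendsto_intros)
  with real show ?thesis
    by (simp add: exp_tail_def)
next
  case top
  then have "filterlim t at_top sequentially"
    using lim by (simp add: ennreal_tendsto_top_eq_at_top)
  then have "filterlim (\<lambda>m. - t m) at_bot sequentially"
    by (simp add: filterlim_uminus_at_bot)
  then have "(\<lambda>m. exp (- t m)) \<longlonglongrightarrow> 0"
    by (rule filterlim_compose[OF exp_at_bot])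
  with top show ?thesis
    by (simp add: exp_tail_def)
qed

text \<open>A measurable image generates a smaller \<sigma>-algebra; this transfers independence
  from the given ingredients to recoded ones.\<close>

lemma events_of_compose:
  assumes g: "g \<in> measurable K L" and f: "f \<in> measurable M K"
  shows "{(\<lambda>\<omega>. g (f \<omega>)) -` A \<inter> space M | A. A \<in> sets L} \<subseteq> events_of M K f"
proof safe
  fix A assume "A \<in> sets L"
  then have "g -` A \<inter> space K \<in> sets K"
    using g by (rule measurable_sets[rotated])
  moreover have "(\<lambda>\<omega>. g (f \<omega>)) -` A \<inter> space M = f -` (g -` A \<inter> space K) \<inter> space M"
    using measurable_space[OF f] by auto
  ultimately show "(\<lambda>\<omega>. g (f \<omega>)) -` A \<inter> space M \<in> events_of M K f"
    unfolding events_of_def by blast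
qed

section \<open>The frequency-hopping network\<close>

text \<open>The setting for arguments at frozen locations: the points enter through measurability
  and independence, while the Poisson law and \<alpha> > d are assumed in the lemmas that average
  over them.\<close>

locale fhma = prob_space M
  for M :: "'w measure" +
  fixes X :: "nat \<Rightarrow> 'w \<Rightarrow> 'a::euclidean_space"
    and h :: "nat \<Rightarrow> nat \<Rightarrow> 'w \<Rightarrow> real"
    and h0 :: "nat \<Rightarrow> 'w \<Rightarrow> real"
    and S :: "nat \<Rightarrow> nat \<Rightarrow> 'w \<Rightarrow> nat"
    and S0 :: "nat \<Rightarrow> 'w \<Rightarrow> nat"
    and \<alpha> r0 \<theta> W N0 :: real
    and N :: nat
  assumes r0: "r0 > 0"
    and theta: "\<theta> > 0"
    and W: "W > 0"
    and N0: "N0 \<ge> 0"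
    and N: "N \<ge> 1"
    and X_meas: "\<And>i. X i \<in> borel_measurable M"
    and fad: "\<And>k i. distributed M lborel (h k i) (exponential_density 1)"
    and fad0: "\<And>k. distributed M lborel (h0 k) (exponential_density 1)"
    and hop: "\<And>k i. S k i \<in> measurable M (count_space UNIV) \<and>
                (\<forall>j\<in>{1..N}. measure M {\<omega> \<in> space M. S k i \<omega> = j} = 1 / real N)"
    and hop0: "\<And>k. S0 k \<in> measurable M (count_space UNIV) \<and>
                (\<forall>j\<in>{1..N}. measure M {\<omega> \<in> space M. S0 k \<omega> = j} = 1 / real N)"
    and indep: "indep_sets
       (\<lambda>j. case j of
              Pts \<Rightarrow> events_of M (Pi\<^sub>M UNIV (\<lambda>_. borel)) (\<lambda>\<omega> i. X i \<omega>)
            | Fad k i \<Rightarrow> events_of M borel (h k i)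
            | Fad0 k \<Rightarrow> events_of M borel (h0 k)
            | Hop k i \<Rightarrow> events_of M (count_space UNIV) (S k i)
            | Hop0 k \<Rightarrow> events_of M (count_space UNIV) (S0 k)) UNIV"
begin

lemma h_meas[measurable]: "h k i \<in> borel_measurable M"
  using distributed_measurable[OF fad] by simp

lemma h0_meas[measurable]: "h0 k \<in> borel_measurable M"
  using distributed_measurable[OF fad0] by simp

lemma S_meas[measurable]: "S k i \<in> measurable M (count_space UNIV)"
  using hop by blast

lemma S0_meas[measurable]: "S0 k \<in> measurable M (count_space UNIV)"
  using hop0 by blast

declare X_meas[measurable]

text \<open>The library's independence notions need variables with a common codomain, so all
  ingredients are embedded into one type.\<close>
abbreviation U :: "((nat \<Rightarrow> 'a) \<times> real) measure" where
  "U \<equiv> (\<Pi>\<^sub>M i\<in>UNIV. borel) \<Otimes>\<^sub>M borel"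

text \<open>The point sequence occupies the first component and every number the second, the other
  component being a dummy 0. Sub-bands are stored as reals and recovered by \<open>nat\<close> of
  the floor.\<close>

definition ingr :: "fh_idx \<Rightarrow> 'w \<Rightarrow> (nat \<Rightarrow> 'a) \<times> real" where
  "ingr j \<omega> = (case j of
       Pts \<Rightarrow> (\<lambda>i. X i \<omega>, 0)
     | Fad k i \<Rightarrow> (\<lambda>_. 0, h k i \<omega>)
     | Fad0 k \<Rightarrow> (\<lambda>_. 0, h0 k \<omega>)
     | Hop k i \<Rightarrow> (\<lambda>_. 0, real (S k i \<omega>))
     | Hop0 k \<Rightarrow> (\<lambda>_. 0, real (S0 k \<omega>)))"

abbreviation ingrs :: "fh_idx set \<Rightarrow> 'w \<Rightarrow> fh_idx \<Rightarrow> (nat \<Rightarrow> 'a) \<times> real" where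
  "ingrs A \<omega> \<equiv> restrict (\<lambda>j. ingr j \<omega>) A"

lemma ingr_snd:
  "snd (ingr (Fad k i) \<omega>) = h k i \<omega>" "snd (ingr (Fad0 k) \<omega>) = h0 k \<omega>"
  "snd (ingr (Hop k i) \<omega>) = real (S k i \<omega>)" "snd (ingr (Hop0 k) \<omega>) = real (S0 k \<omega>)"
  by (simp_all add: ingr_def)

lemma X_seq_meas[measurable]: "(\<lambda>\<omega> i. X i \<omega>) \<in> measurable M (\<Pi>\<^sub>M i\<in>UNIV. borel)"
  by (rule measurable_PiM_single') auto

lemma indep_vars_ingr: "indep_vars (\<lambda>_. U) ingr UNIV"
proof -
  have zero: "(\<lambda>_. 0 :: 'a) \<in> space (\<Pi>\<^sub>M i\<in>(UNIV::nat set). borel)"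
    by (simp add: space_PiM)
  have pair0: "(\<lambda>r. (\<lambda>_. 0, r)) \<in> measurable borel U"
    using zero by (intro measurable_Pair) auto
  have pair0': "(\<lambda>n. (\<lambda>_. 0, real n)) \<in> measurable (count_space UNIV) U"
    using zero by (intro measurable_Pair) auto
  have pts: "(\<lambda>x. (x, 0)) \<in> measurable (\<Pi>\<^sub>M i\<in>UNIV. borel) U"
    by (intro measurable_Pair) auto
  have "random_variable U (ingr j)" for j
    unfolding ingr_def[abs_def]
    by (cases j) (auto intro!: measurable_compose[OF _ pair0] measurable_compose[OF _ pair0']
        measurable_compose[OF X_seq_meas pts])
  moreover have "indep_sets (\<lambda>j. {ingr j -` A \<inter> space M | A. A \<in> sets U}) UNIV"
  proof (rule indep_sets_mono_sets[OF indep], goal_cases)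
    case (1 j)
    show ?case
      unfolding ingr_def[abs_def]
      by (cases j) (simp_all only: fh_idx.case events_of_compose[OF pts X_seq_meas]
          events_of_compose[OF pair0 h_meas] events_of_compose[OF pair0 h0_meas]
          events_of_compose[OF pair0' S_meas] events_of_compose[OF pair0' S0_meas])
  qed
  ultimately show ?thesis
    unfolding indep_vars_def2 by simp
qed

text \<open>Disjoint groups of ingredients are independent, so one group can be averaged while the
  other is frozen. All conditioning below takes this form.\<close>

lemma ingr_Fubini:
  assumes "A \<inter> B = {}" "case_prod f \<in> borel_measurable (PiM A (\<lambda>_. U) \<Otimes>\<^sub>M PiM B (\<lambda>_. U))"
  shows "(\<integral>\<^sup>+ \<omega>. f (ingrs A \<omega>) (ingrs B \<omega>) \<partial>M) = (\<integral>\<^sup>+ \<omega>. \<integral>\<^sup>+ \<omega>'. f (ingrs A \<omega>) (ingrs B \<omega>') \<partial>M \<partial>M)"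
  using assms by (intro indep_var_nn_integral[OF indep_var_restrict[OF indep_vars_ingr]]) auto

lemma ingr_component:
  assumes f: "f \<in> measurable K (PiM A (\<lambda>_. U))" and j: "j \<in> A"
  shows "(\<lambda>z. fst (f z j) i) \<in> borel_measurable K"
    and "(\<lambda>z. snd (f z j)) \<in> borel_measurable K"
    and "(\<lambda>z. nat \<lfloor>snd (f z j)\<rfloor>) \<in> measurable K (count_space UNIV)"
proof -
  have 1[measurable]: "(\<lambda>z. f z j) \<in> measurable K U"
    using measurable_compose[OF f measurable_component_singleton[OF j]] .
  have 2[measurable]: "(\<lambda>z. fst (f z j)) \<in> measurable K (\<Pi>\<^sub>M i\<in>UNIV. borel)"
    by measurable
  show "(\<lambda>z. fst (f z j) i) \<in> borel_measurable K"
    using measurable_compose[OF 2 measurable_component_singleton[of i]] by simp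
  show 3[measurable]: "(\<lambda>z. snd (f z j)) \<in> borel_measurable K"
    by measurable
  show "(\<lambda>z. nat \<lfloor>snd (f z j)\<rfloor>) \<in> measurable K (count_space UNIV)"
    by measurable
qed

section \<open>Conditioning on the interferer locations\<close>

abbreviation succ_at :: "(nat \<Rightarrow> 'a) \<Rightarrow> nat \<Rightarrow> 'w \<Rightarrow> bool" where
  "succ_at x \<equiv> fh_success (\<lambda>i _. x i) h h0 S S0 \<alpha> r0 \<theta> N W N0"

lemma nn_integral_delay_points:
  "(\<integral>\<^sup>+ \<omega>. local_delay (fh_success X h h0 S S0 \<alpha> r0 \<theta> N W N0) N \<omega> \<partial>M) =
   (\<integral>\<^sup>+ \<omega>. \<integral>\<^sup>+ \<omega>'. local_delay (succ_at (\<lambda>i. X i \<omega>)) N \<omega>' \<partial>M \<partial>M)"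
proof -
  \<comment> \<open>Slot success as a function of ingredient tuples: the locations are read from the
    first tuple, everything else from the second.\<close>
  define P :: "nat \<Rightarrow> (fh_idx \<Rightarrow> (nat \<Rightarrow> 'a) \<times> real) \<times> (fh_idx \<Rightarrow> (nat \<Rightarrow> 'a) \<times> real) \<Rightarrow> bool"
    where "P = fh_success (\<lambda>i z. fst (fst z Pts) i)
      (\<lambda>k i z. snd (snd z (Fad k i)) :: real) (\<lambda>k z. snd (snd z (Fad0 k)))
      (\<lambda>k i z. nat \<lfloor>snd (snd z (Hop k i))\<rfloor>) (\<lambda>k z. nat \<lfloor>snd (snd z (Hop0 k))\<rfloor>) \<alpha> r0 \<theta> N W N0"
  define f where "f y z = local_delay P N (y, z)" for y z
  have "case_prod f = local_delay P N"
    by (auto simp: f_def fun_eq_iff)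
  then have f: "case_prod f \<in> borel_measurable (PiM {Pts} (\<lambda>_. U) \<Otimes>\<^sub>M PiM (- {Pts}) (\<lambda>_. U))"
    unfolding P_def
    by (auto intro!: measurable_local_delay pred_fh_success ingr_component(1)[where A="{Pts}"]
        ingr_component(2,3)[where A="- {Pts}"])
  have P: "P k (ingrs {Pts} \<omega>, ingrs (- {Pts}) \<omega>') = succ_at (\<lambda>i. X i \<omega>) k \<omega>'" for k \<omega> \<omega>'
    by (simp add: P_def fh_success_def fh_interference_def ingr_def)
  have "(\<integral>\<^sup>+ \<omega>. local_delay (fh_success X h h0 S S0 \<alpha> r0 \<theta> N W N0) N \<omega> \<partial>M) =
      (\<integral>\<^sup>+ \<omega>. f (ingrs {Pts} \<omega>) (ingrs (- {Pts}) \<omega>) \<partial>M)"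
    unfolding f_def
    by (intro nn_integral_cong local_delay_cong, subst P) (simp add: fh_success_def fh_interference_def)
  also have "\<dots> = (\<integral>\<^sup>+ \<omega>. \<integral>\<^sup>+ \<omega>'. f (ingrs {Pts} \<omega>) (ingrs (- {Pts}) \<omega>') \<partial>M \<partial>M)"
    using f by (intro ingr_Fubini) auto
  also have "\<dots> = (\<integral>\<^sup>+ \<omega>. \<integral>\<^sup>+ \<omega>'. local_delay (succ_at (\<lambda>i. X i \<omega>)) N \<omega>' \<partial>M \<partial>M)"
    unfolding f_def by (intro nn_integral_cong local_delay_cong) (simp add: P)
  finally show ?thesis .
qed

text \<open>With the locations frozen, slot \<open>k\<close> depends only on the ingredients
  \<open>L k\<close> carrying its own index, and these sets are disjoint.\<close>

lemma indep_vars_succ_at: "indep_vars (\<lambda>_. count_space UNIV) (succ_at x) UNIV"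
proof -
  define L where "L k = insert (Fad0 k) (insert (Hop0 k) (range (Fad k) \<union> range (Hop k)))" for k
  define P :: "nat \<Rightarrow> (fh_idx \<Rightarrow> (nat \<Rightarrow> 'a) \<times> real) \<Rightarrow> bool" where "P = fh_success (\<lambda>i y. x i)
      (\<lambda>k i y. snd (y (Fad k i)) :: real) (\<lambda>k y. snd (y (Fad0 k)))
      (\<lambda>k i y. nat \<lfloor>snd (y (Hop k i))\<rfloor>) (\<lambda>k y. nat \<lfloor>snd (y (Hop0 k))\<rfloor>) \<alpha> r0 \<theta> N W N0"
  have "disjoint_family_on L UNIV"
    by (auto simp: disjoint_family_on_def L_def)
  then have "indep_vars (\<lambda>k. PiM (L k) (\<lambda>_. U)) (\<lambda>k. ingrs (L k)) UNIV"
    by (intro indep_vars_restrict[OF indep_vars_ingr]) auto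
  moreover have "P k \<in> measurable (PiM (L k) (\<lambda>_. U)) (count_space UNIV)" for k
    unfolding P_def
    by (intro pred_fh_success ingr_component[where A="L k"]) (auto simp: L_def)
  ultimately have "indep_vars (\<lambda>_. count_space UNIV) (\<lambda>k \<omega>. P k (ingrs (L k) \<omega>)) UNIV"
    by (rule indep_vars_compose2)
  moreover have "(\<lambda>k \<omega>. P k (ingrs (L k) \<omega>)) = succ_at x"
    by (auto simp: P_def fh_success_def fh_interference_def ingr_def L_def fun_eq_iff)
  ultimately show ?thesis by simp
qed

section \<open>Success probability of a slot at fixed locations\<close>

definition gain :: "'a \<Rightarrow> real" where
  "gain x = \<theta> * r0 powr \<alpha> * norm x powr (- \<alpha>)"

lemma gain_nonneg: "gain x \<ge> 0"
  using theta by (simp add: gain_def)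

text \<open>Chosen so that \<open>1 / (1 + excess x)\<close> is the probability that an interferer at \<open>x\<close> does
  not spoil a slot.\<close>
definition excess :: "'a \<Rightarrow> real" where
  "excess x = (gain x / real N) / (1 + gain x * (real N - 1) / real N)"

lemma excess_nonneg: "excess x \<ge> 0"
  using gain_nonneg[of x] N by (simp add: excess_def)

text \<open>The right side is the mean over the two cases of one interferer: no collision, with
  factor 1, and a collision of probability 1/N, with the Laplace factor 1 / (1 + gain).\<close>

lemma inverse_excess: "1 / (1 + excess x) = 1 - 1 / real N + (1 / real N) * (1 / (1 + gain x))"
proof -
  define a where "a = 1 + gain x * (real N - 1) / real N"
  have pos: "a > 0" "1 + gain x > 0" "real N > 0"
    unfolding a_def using gain_nonneg[of x] N by (auto intro!: add_pos_nonneg)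
  have excess: "excess x = (gain x / real N) / a"
    by (simp only: excess_def a_def)
  have "1 + excess x = (a + gain x / real N) / a"
    using pos by (simp add: excess a_def[symmetric] add_divide_distrib)
  also have "a + gain x / real N = 1 + gain x"
    using pos by (simp add: a_def field_simps)
  finally have "1 / (1 + excess x) = a / (1 + gain x)"
    by simp
  also have "a = (1 - 1 / real N) * (1 + gain x) + 1 / real N"
    using pos by (simp add: a_def field_simps)
  finally show ?thesis
    using pos by (simp add: add_divide_distrib)
qed

text \<open>The desired sub-band appears as a constant \<open>s\<close>, since it is shared by all
  interferers and is frozen before they are averaged.\<close>

lemma nn_integral_interferer:
  assumes s: "s \<in> {1..N}"
  shows "(\<integral>\<^sup>+ \<omega>. ennreal (if S k i \<omega> = s then exp (- (gain x * max 0 (h k i \<omega>))) else 1) \<partial>M) =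
    ennreal (1 / (1 + excess x))"
proof -
  define f where "f y z = ennreal (if nat \<lfloor>snd (y (Hop k i))\<rfloor> = s
      then exp (- (gain x * max 0 (snd (z (Fad k i))))) else 1)"
    for y z :: "fh_idx \<Rightarrow> (nat \<Rightarrow> 'a) \<times> real"
  let ?K = "PiM {Hop k i} (\<lambda>_. U) \<Otimes>\<^sub>M PiM {Fad k i} (\<lambda>_. U)"
  have [measurable]: "(\<lambda>z. nat \<lfloor>snd (fst z (Hop k i))\<rfloor>) \<in> measurable ?K (count_space UNIV)"
    "(\<lambda>z. snd (snd z (Fad k i))) \<in> borel_measurable ?K"
    by (auto intro!: ingr_component[where A="{Hop k i}"] ingr_component[where A="{Fad k i}"])
  have f: "case_prod f \<in> borel_measurable ?K"
    unfolding f_def case_prod_beta' by measurable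
  have "(\<integral>\<^sup>+ \<omega>. ennreal (if S k i \<omega> = s then exp (- (gain x * max 0 (h k i \<omega>))) else 1) \<partial>M) =
      (\<integral>\<^sup>+ \<omega>. f (ingrs {Hop k i} \<omega>) (ingrs {Fad k i} \<omega>) \<partial>M)"
    by (simp add: f_def ingr_def cong: if_cong)
  also have "\<dots> = (\<integral>\<^sup>+ \<omega>. \<integral>\<^sup>+ \<omega>'. f (ingrs {Hop k i} \<omega>) (ingrs {Fad k i} \<omega>') \<partial>M \<partial>M)"
    using f by (intro ingr_Fubini) auto
  also have "\<dots> = (\<integral>\<^sup>+ \<omega>. (if S k i \<omega> = s then ennreal (1 / (1 + gain x)) else 1) \<partial>M)"
  proof (rule nn_integral_cong)
    fix \<omega>
    have "(\<integral>\<^sup>+ \<omega>'. f (ingrs {Hop k i} \<omega>) (ingrs {Fad k i} \<omega>') \<partial>M) =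
        (\<integral>\<^sup>+ \<omega>'. ennreal (if S k i \<omega> = s then exp (- (gain x * max 0 (h k i \<omega>'))) else 1) \<partial>M)"
      by (simp add: f_def ingr_def cong: if_cong)
    then show "(\<integral>\<^sup>+ \<omega>'. f (ingrs {Hop k i} \<omega>) (ingrs {Fad k i} \<omega>') \<partial>M) =
        (if S k i \<omega> = s then ennreal (1 / (1 + gain x)) else 1)"
      using exponential_Laplace[OF fad gain_nonneg] by (simp add: emeasure_space_1)
  qed
  also have "\<dots> = (\<integral>\<^sup>+ \<omega>. ennreal (1 / (1 + gain x)) * indicator {\<omega> \<in> space M. S k i \<omega> = s} \<omega> +
      indicator (space M - {\<omega> \<in> space M. S k i \<omega> = s}) \<omega> \<partial>M)"
    by (intro nn_integral_cong) (auto simp: indicator_def)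
  also have "\<dots> = ennreal (1 / (1 + gain x)) * emeasure M {\<omega> \<in> space M. S k i \<omega> = s} +
      emeasure M (space M - {\<omega> \<in> space M. S k i \<omega> = s})"
    by (subst nn_integral_add) (simp_all add: nn_integral_cmult_indicator)
  also have "\<dots> = ennreal (1 / (1 + gain x)) * ennreal (1 / real N) + ennreal (1 - 1 / real N)"
  proof -
    have "prob {\<omega> \<in> space M. S k i \<omega> = s} = 1 / real N"
      using hop s by blast
    then show ?thesis
      by (simp add: emeasure_eq_measure prob_compl)
  qed
  also have "\<dots> = ennreal (1 / (1 + excess x))"
    using gain_nonneg[of x] N
    by (simp add: inverse_excess ennreal_mult[symmetric] ennreal_plus[symmetric] add.commute mult.commute
        del: ennreal_plus)
  finally show ?thesis .
qed

text \<open>The \<open>N\<close> masses 1/N already add up to 1, so no other sub-band number has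
  positive probability.\<close>

lemma AE_S0: "AE \<omega> in M. S0 k \<omega> \<in> {1..N}"
proof -
  have "prob {\<omega> \<in> space M. S0 k \<omega> \<in> {1..N}} = prob (\<Union>j\<in>{1..N}. {\<omega> \<in> space M. S0 k \<omega> = j})"
    by (intro arg_cong[where f=prob]) auto
  also have "\<dots> = (\<Sum>j\<in>{1..N}. prob {\<omega> \<in> space M. S0 k \<omega> = j})"
    by (intro finite_measure_finite_Union) (auto simp: disjoint_family_on_def)
  also have "\<dots> = (\<Sum>j\<in>{1..N}. 1 / real N)"
    using hop0 by (intro sum.cong) auto
  also have "\<dots> = 1" using N by simp
  finally show ?thesis
    by (subst (asm) prob_Collect_eq_1) auto
qed

text \<open>The factors are coupled through \<open>S0 k\<close>. Once it is frozen they depend on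
  the disjoint pairs \<open>{Hop k i, Fad k i}\<close> and are independent, and their means are the
  same for every sub-band in \<open>{1..N}\<close>, so averaging over \<open>S0 k\<close> changes
  nothing.\<close>

lemma nn_integral_interferers:
  "(\<integral>\<^sup>+ \<omega>. (\<Prod>i<m. ennreal (if S k i \<omega> = S0 k \<omega> then exp (- (gain (x i) * max 0 (h k i \<omega>))) else 1)) \<partial>M) =
    (\<Prod>i<m. ennreal (1 / (1 + excess (x i))))"
proof -
  define g where "g i s y = ennreal (if nat \<lfloor>snd (y (Hop k i))\<rfloor> = s
      then exp (- (gain (x i) * max 0 (snd (y (Fad k i))))) else 1)"
    for i s and y :: "fh_idx \<Rightarrow> (nat \<Rightarrow> 'a) \<times> real"
  define f where "f y z = (\<Prod>i<m. g i (nat \<lfloor>snd (y (Hop0 k))\<rfloor>) z)"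
    for y z :: "fh_idx \<Rightarrow> (nat \<Rightarrow> 'a) \<times> real"
  let ?R = "range (Hop k) \<union> range (Fad k)"
  let ?K = "PiM {Hop0 k} (\<lambda>_. U) \<Otimes>\<^sub>M PiM ?R (\<lambda>_. U)"
  have [measurable]: "(\<lambda>z. nat \<lfloor>snd (fst z (Hop0 k))\<rfloor>) \<in> measurable ?K (count_space UNIV)"
    "(\<lambda>z. nat \<lfloor>snd (snd z (Hop k i))\<rfloor>) \<in> measurable ?K (count_space UNIV)"
    "(\<lambda>z. snd (snd z (Fad k i))) \<in> borel_measurable ?K" for i
    by (auto intro!: ingr_component[where A="{Hop0 k}"] ingr_component[where A="?R"])
  have f: "case_prod f \<in> borel_measurable ?K"
    unfolding f_def g_def case_prod_beta' by measurable
  have g_ingr: "g i s (ingrs A \<omega>) =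
      ennreal (if S k i \<omega> = s then exp (- (gain (x i) * max 0 (h k i \<omega>))) else 1)"
    if "Hop k i \<in> A" "Fad k i \<in> A" for i s A \<omega>
    using that by (simp add: g_def ingr_def cong: if_cong)
  have "(\<integral>\<^sup>+ \<omega>. (\<Prod>i<m. ennreal (if S k i \<omega> = S0 k \<omega> then exp (- (gain (x i) * max 0 (h k i \<omega>))) else 1)) \<partial>M) =
      (\<integral>\<^sup>+ \<omega>. f (ingrs {Hop0 k} \<omega>) (ingrs ?R \<omega>) \<partial>M)"
    by (simp add: f_def g_ingr ingr_snd)
  also have "\<dots> = (\<integral>\<^sup>+ \<omega>. \<integral>\<^sup>+ \<omega>'. f (ingrs {Hop0 k} \<omega>) (ingrs ?R \<omega>') \<partial>M \<partial>M)"
    using f by (intro ingr_Fubini) auto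
  also have "\<dots> = (\<integral>\<^sup>+ \<omega>. (\<Prod>i<m. ennreal (1 / (1 + excess (x i)))) \<partial>M)"
  proof (rule nn_integral_cong_AE)
    show "AE \<omega> in M. (\<integral>\<^sup>+ \<omega>'. f (ingrs {Hop0 k} \<omega>) (ingrs ?R \<omega>') \<partial>M) =
        (\<Prod>i<m. ennreal (1 / (1 + excess (x i))))"
      using AE_S0[of k]
    proof eventually_elim
      case (elim \<omega>)
      let ?s = "S0 k \<omega>"
      let ?L = "\<lambda>i. {Hop k i, Fad k i}"
      have "disjoint_family_on ?L {..<m}"
        by (auto simp: disjoint_family_on_def)
      then have "indep_vars (\<lambda>i. PiM (?L i) (\<lambda>_. U)) (\<lambda>i. ingrs (?L i)) {..<m}"
        by (intro indep_vars_restrict[OF indep_vars_ingr]) auto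
      moreover have "g i ?s \<in> borel_measurable (PiM (?L i) (\<lambda>_. U))" for i
      proof -
        have [measurable]: "(\<lambda>z. nat \<lfloor>snd (z (Hop k i))\<rfloor>) \<in> measurable (PiM (?L i) (\<lambda>_. U)) (count_space UNIV)"
          "(\<lambda>z. snd (z (Fad k i))) \<in> borel_measurable (PiM (?L i) (\<lambda>_. U))"
          by (auto intro!: ingr_component[where A="?L i"])
        show ?thesis
          unfolding g_def by measurable
      qed
      ultimately have ind: "indep_vars (\<lambda>_. borel) (\<lambda>i \<omega>'. g i ?s (ingrs (?L i) \<omega>')) {..<m}"
        by (rule indep_vars_compose2)
      have "(\<integral>\<^sup>+ \<omega>'. f (ingrs {Hop0 k} \<omega>) (ingrs ?R \<omega>') \<partial>M) =
          (\<integral>\<^sup>+ \<omega>'. (\<Prod>i<m. g i ?s (ingrs (?L i) \<omega>')) \<partial>M)"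
        by (simp add: f_def g_ingr ingr_snd)
      also have "\<dots> = (\<Prod>i<m. \<integral>\<^sup>+ \<omega>'. g i ?s (ingrs (?L i) \<omega>') \<partial>M)"
        by (rule indep_vars_nn_integral[OF _ ind]) auto
      also have "\<dots> = (\<Prod>i<m. ennreal (1 / (1 + excess (x i))))"
        using nn_integral_interferer[OF elim] by (simp add: g_ingr)
      finally show ?case .
    qed
  qed
  also have "\<dots> = (\<Prod>i<m. ennreal (1 / (1 + excess (x i))))"
    by (simp add: emeasure_space_1)
  finally show ?thesis .
qed

text \<open>The thermal part of the threshold for the desired fading; it equals B / N.\<close>

definition noise :: real where
  "noise = \<theta> * r0 powr \<alpha> * (W * N0 / real N)"

lemma noise_nonneg: "noise \<ge> 0"
  using theta W N0 by (simp add: noise_def)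

text \<open>The exponential tail turns the probability into the mean of exp(-T), where T is the
  random threshold. Truncating the interference to \<open>m\<close> terms makes this mean a finite
  product, and dominated convergence with bound 1 removes the truncation. The limit may be
  0.\<close>

lemma prob_succ_at:
  "(\<lambda>m. exp (- noise) * (\<Prod>i<m. 1 / (1 + excess (x i)))) \<longlonglongrightarrow> prob {\<omega> \<in> space M. succ_at x k \<omega>}"
proof -
  define T where "T \<omega> = ennreal (\<theta> * r0 powr \<alpha>) *
      (ennreal (W * N0 / real N) + fh_interference (\<lambda>i _. x i) h S S0 \<alpha> k \<omega>)" for \<omega>
  have T_meas[measurable]: "T \<in> borel_measurable M"
    unfolding T_def
    by (intro borel_measurable_times_ennreal borel_measurable_add borel_measurable_const measurable_fh_interference)
      simp_all
  \<comment> \<open>Real-valued thresholds with the first \<open>m\<close> interferers only. The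
    maximum with 0 mirrors \<open>ennreal\<close>, which sends negative numbers to 0.\<close>
  define t where "t m \<omega> = noise +
      (\<Sum>i<m. if S k i \<omega> = S0 k \<omega> then gain (x i) * max 0 (h k i \<omega>) else 0)" for m \<omega>
  have S_eq: "Measurable.pred M (\<lambda>\<omega>. S k i \<omega> = S0 k \<omega>)" for i
    by (intro pred_eq_nat) auto
  have t0: "t m \<omega> \<ge> 0" for m \<omega>
    unfolding t_def using noise_nonneg gain_nonneg by (intro add_nonneg_nonneg sum_nonneg) auto
  have t_eq: "ennreal (t m \<omega>) = ennreal (\<theta> * r0 powr \<alpha>) * (ennreal (W * N0 / real N) +
      (\<Sum>i<m. ennreal (h k i \<omega> * norm (x i) powr (- \<alpha>)) * (if S k i \<omega> = S0 k \<omega> then 1 else 0)))" for m \<omega>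
  proof -
    define v where "v i = (if S k i \<omega> = S0 k \<omega> then norm (x i) powr (- \<alpha>) * max 0 (h k i \<omega>) else 0)" for i
    have v0: "v i \<ge> 0" for i
      by (simp add: v_def)
    have "ennreal (h k i \<omega> * norm (x i) powr (- \<alpha>)) * (if S k i \<omega> = S0 k \<omega> then 1 else 0) =
        ennreal (v i)" for i
    proof (cases "0 \<le> h k i \<omega>")
      case False
      then have "h k i \<omega> * norm (x i) powr (- \<alpha>) \<le> 0"
        by (intro mult_nonpos_nonneg) auto
      with False show ?thesis
        by (simp add: v_def max_def ennreal_neg)
    qed (simp add: v_def max_def mult.commute)
    moreover have "t m \<omega> = \<theta> * r0 powr \<alpha> * (W * N0 / real N + (\<Sum>i<m. v i))"
      unfolding t_def noise_def gain_def distrib_left sum_distrib_left v_def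
      by (intro arg_cong2[where f="(+)"] sum.cong) (auto simp: mult.assoc)
    ultimately show ?thesis
      using theta W N0 v0
      by (simp add: sum_ennreal ennreal_plus[symmetric] ennreal_mult[symmetric] sum_nonneg
          del: ennreal_plus)
  qed
  have lim_t: "(\<lambda>m. ennreal (t m \<omega>)) \<longlonglongrightarrow> T \<omega>" for \<omega>
    unfolding t_eq T_def fh_interference_def
    by (intro tendsto_intros ennreal_tendsto_cmult summable_LIMSEQ) auto
  have "emeasure M {\<omega> \<in> space M. succ_at x k \<omega>} = (\<integral>\<^sup>+ \<omega>. ennreal (exp_tail (T \<omega>)) \<partial>M)"
  proof -
    \<comment> \<open>The desired fading is separated from the rest of the slot: with the rest
      frozen, success means that a unit exponential exceeds the constant
      \<open>T \<omega>\<close>.\<close>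
    let ?R = "insert (Hop0 k) (range (Hop k) \<union> range (Fad k))"
    let ?K = "PiM ?R (\<lambda>_. U) \<Otimes>\<^sub>M PiM {Fad0 k} (\<lambda>_. U)"
    define P :: "(fh_idx \<Rightarrow> (nat \<Rightarrow> 'a) \<times> real) \<times> (fh_idx \<Rightarrow> (nat \<Rightarrow> 'a) \<times> real) \<Rightarrow> bool" where "P = fh_success (\<lambda>i z. x i)
        (\<lambda>k i z. snd (fst z (Fad k i)) :: real) (\<lambda>k z. snd (snd z (Fad0 k)))
        (\<lambda>k i z. nat \<lfloor>snd (fst z (Hop k i))\<rfloor>) (\<lambda>k z. nat \<lfloor>snd (fst z (Hop0 k))\<rfloor>) \<alpha> r0 \<theta> N W N0 k"
    define f where "f y z = (if P (y, z) then 1 else 0 :: ennreal)"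
      for y z :: "fh_idx \<Rightarrow> (nat \<Rightarrow> 'a) \<times> real"
    have [measurable]: "Measurable.pred ?K P"
      unfolding P_def by (rule pred_fh_success)
        (auto intro!: ingr_component[where A="?R"] ingr_component[where A="{Fad0 k}"])
    have f: "case_prod f \<in> borel_measurable ?K"
      unfolding f_def case_prod_beta' by (simp add: prod.collapse)
    have P: "P (ingrs ?R \<omega>, ingrs {Fad0 k} \<omega>') \<longleftrightarrow> T \<omega> < ennreal (h0 k \<omega>')" for \<omega> \<omega>'
    proof -
      have "P (ingrs ?R \<omega>, ingrs {Fad0 k} \<omega>') \<longleftrightarrow>
          fh_success (\<lambda>i _. x i) (\<lambda>k i _. h k i \<omega>) h0 (\<lambda>k i _. S k i \<omega>) (\<lambda>k _. S0 k \<omega>) \<alpha> r0 \<theta> N W N0 k \<omega>'"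
        by (simp add: P_def fh_success_def fh_interference_def ingr_def)
      also have "\<dots> \<longleftrightarrow> T \<omega> < ennreal (h0 k \<omega>')"
        using theta r0 W N0 by (simp add: fh_success_iff T_def fh_interference_def)
      finally show ?thesis .
    qed
    have "emeasure M {\<omega> \<in> space M. succ_at x k \<omega>} = (\<integral>\<^sup>+ \<omega>. indicator {\<omega> \<in> space M. T \<omega> < ennreal (h0 k \<omega>)} \<omega> \<partial>M)"
      using theta r0 W N0 by (simp add: fh_success_iff T_def[symmetric])
    also have "\<dots> = (\<integral>\<^sup>+ \<omega>. f (ingrs ?R \<omega>) (ingrs {Fad0 k} \<omega>) \<partial>M)"
      unfolding f_def P by (intro nn_integral_cong) (simp add: indicator_def)
    also have "\<dots> = (\<integral>\<^sup>+ \<omega>. \<integral>\<^sup>+ \<omega>'. f (ingrs ?R \<omega>) (ingrs {Fad0 k} \<omega>') \<partial>M \<partial>M)"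
      using f by (intro ingr_Fubini) auto
    also have "\<dots> = (\<integral>\<^sup>+ \<omega>. \<integral>\<^sup>+ \<omega>'. indicator {\<omega>' \<in> space M. T \<omega> < ennreal (h0 k \<omega>')} \<omega>' \<partial>M \<partial>M)"
      unfolding f_def P by (intro nn_integral_cong) (simp add: indicator_def)
    also have "\<dots> = (\<integral>\<^sup>+ \<omega>. ennreal (exp_tail (T \<omega>)) \<partial>M)"
      using emeasure_exponential_gt[OF fad0] by (intro nn_integral_cong) simp
    finally show ?thesis .
  qed
  moreover have "(\<lambda>m. \<integral>\<^sup>+ \<omega>. ennreal (exp (- t m \<omega>)) \<partial>M) \<longlonglongrightarrow> (\<integral>\<^sup>+ \<omega>. ennreal (exp_tail (T \<omega>)) \<partial>M)"
  proof (rule nn_integral_dominated_convergence[where w="\<lambda>_. 1"])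
    have [measurable]: "t m \<in> borel_measurable M" for m
      unfolding t_def using S_eq
      by (intro borel_measurable_add borel_measurable_const borel_measurable_sum measurable_If) auto
    show "(\<lambda>\<omega>. ennreal (exp (- t m \<omega>))) \<in> borel_measurable M" for m
      by measurable
    show "(\<lambda>\<omega>. ennreal (exp_tail (T \<omega>))) \<in> borel_measurable M"
      unfolding exp_tail_def by measurable
    show "AE \<omega> in M. ennreal (exp (- t m \<omega>)) \<le> 1" for m
      using t0 by simp
    show "AE \<omega> in M. (\<lambda>m. ennreal (exp (- t m \<omega>))) \<longlonglongrightarrow> ennreal (exp_tail (T \<omega>))"
      using exp_tail_tendsto[OF t0 lim_t] by (intro AE_I2 tendsto_ennrealI)
  qed (simp_all add: emeasure_space_1)
  moreover have "(\<integral>\<^sup>+ \<omega>. ennreal (exp (- t m \<omega>)) \<partial>M) =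
      ennreal (exp (- noise) * (\<Prod>i<m. 1 / (1 + excess (x i))))" for m
  proof -
    have "ennreal (exp (- t m \<omega>)) = ennreal (exp (- noise)) *
        (\<Prod>i<m. ennreal (if S k i \<omega> = S0 k \<omega> then exp (- (gain (x i) * max 0 (h k i \<omega>))) else 1))" for \<omega>
    proof -
      have "exp (- t m \<omega>) = exp (- noise) *
          (\<Prod>i<m. if S k i \<omega> = S0 k \<omega> then exp (- (gain (x i) * max 0 (h k i \<omega>))) else 1)"
        unfolding t_def minus_add_distrib exp_add sum_negf[symmetric] exp_sum[OF finite_lessThan]
        by (intro arg_cong2[where f="(*)"] prod.cong) auto
      then show ?thesis
        by (simp add: ennreal_mult prod_ennreal prod_nonneg)
    qed
    then have "(\<integral>\<^sup>+ \<omega>. ennreal (exp (- t m \<omega>)) \<partial>M) =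
        ennreal (exp (- noise)) * (\<Prod>i<m. ennreal (1 / (1 + excess (x i))))"
    proof (simp only:, subst nn_integral_cmult)
      show "(\<lambda>\<omega>. \<Prod>i<m. ennreal (if S k i \<omega> = S0 k \<omega> then exp (- (gain (x i) * max 0 (h k i \<omega>))) else 1))
          \<in> borel_measurable M"
        using S_eq by (intro borel_measurable_prod_ennreal measurable_compose[OF _ measurable_ennreal]
            measurable_If) auto
    qed (simp only: nn_integral_interferers)
    also have "\<dots> = ennreal (exp (- noise) * (\<Prod>i<m. 1 / (1 + excess (x i))))"
      using excess_nonneg by (simp add: ennreal_mult prod_ennreal prod_nonneg add_nonneg_nonneg)
    finally show ?thesis .
  qed
  ultimately have "(\<lambda>m. ennreal (exp (- noise) * (\<Prod>i<m. 1 / (1 + excess (x i))))) \<longlonglongrightarrow>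
      ennreal (prob {\<omega> \<in> space M. succ_at x k \<omega>})"
    by (simp add: emeasure_eq_measure)
  then show ?thesis
    using excess_nonneg by (subst (asm) tendsto_ennreal_iff) (auto intro!: always_eventually mult_nonneg_nonneg
        prod_nonneg divide_nonneg_nonneg add_nonneg_nonneg)
qed

lemma nn_integral_delay_at:
  "(\<integral>\<^sup>+ \<omega>. local_delay (succ_at x) N \<omega> \<partial>M) =
    ennreal (real N * exp noise) * (SUP m. ennreal (\<Prod>i<m. 1 + excess (x i)))"
proof -
  define p where "p = prob {\<omega> \<in> space M. succ_at x 0 \<omega>}"
  \<comment> \<open>The limit in \<open>prob_succ_at\<close> is of a sequence not involving
    \<open>k\<close>, so its uniqueness makes all slots equally likely to succeed.\<close>
  have p: "prob {\<omega> \<in> space M. succ_at x k \<omega>} = p" for k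
    unfolding p_def using LIMSEQ_unique[OF prob_succ_at prob_succ_at] .
  define Q where "Q m = (\<Prod>i<m. 1 + excess (x i))" for m
  have Q: "Q m > 0" for m
    unfolding Q_def using excess_nonneg by (intro prod_pos) (auto intro: add_pos_nonneg)
  have "(\<lambda>m. ennreal (exp (- noise) * (1 / Q m))) \<longlonglongrightarrow> ennreal p"
    using prob_succ_at[of x 0] by (intro tendsto_ennrealI) (simp add: p_def Q_def prod_dividef)
  \<comment> \<open>Inversion is continuous on all of [0, \<infinity>], so success probability 0
    needs no separate treatment and gives \<infinity>.\<close>
  then have "(\<lambda>m. inverse (ennreal (exp (- noise) * (1 / Q m)))) \<longlonglongrightarrow> inverse (ennreal p)"
    by (rule continuous_on_tendsto_compose[OF continuous_on_inverse_ennreal[OF continuous_on_id], of _ _ _ UNIV, simplified])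
  also have "(\<lambda>m. inverse (ennreal (exp (- noise) * (1 / Q m)))) = (\<lambda>m. ennreal (exp noise) * ennreal (Q m))"
    using Q by (auto simp: inverse_ennreal ennreal_mult[symmetric] less_imp_le exp_minus field_simps)
  finally have "(\<lambda>m. ennreal (exp noise) * ennreal (Q m)) \<longlonglongrightarrow> inverse (ennreal p)" .
  moreover have "(\<lambda>m. ennreal (exp noise) * ennreal (Q m)) \<longlonglongrightarrow> (SUP m. ennreal (exp noise) * ennreal (Q m))"
  proof (intro LIMSEQ_SUP incseq_SucI mult_left_mono ennreal_leI)
    fix m
    have "Q m * 1 \<le> Q m * (1 + excess (x m))"
      using Q[of m] excess_nonneg by (intro mult_left_mono) auto
    then show "Q m \<le> Q (Suc m)" by (simp add: Q_def)
  qed auto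
  ultimately have "inverse (ennreal p) = (SUP m. ennreal (exp noise) * ennreal (Q m))"
    by (rule LIMSEQ_unique)
  then show ?thesis
    using nn_integral_local_delay_iid[OF indep_vars_succ_at p, of N]
    by (simp add: divide_ennreal_def SUP_mult_left_ennreal[symmetric] Q_def ennreal_mult mult.assoc)
qed

section \<open>Averaging over the interferer locations\<close>

lemma excess_meas[measurable]: "excess \<in> borel_measurable borel"
  unfolding excess_def[abs_def] gain_def by measurable

text \<open>Away from the origin, \<open>excess x\<close> is 1 / (N - 1) times b / (b +
  |x|^\<alpha>) with b = \<theta> r0^\<alpha> (N - 1) / N, the kernel of the Beta computation. The
  prefactor together with b^\<delta> produces the powers of N - 1 and N.\<close>

lemma nn_integral_excess:
  assumes \<alpha>: "\<alpha> > real DIM('a)" and N2: "N \<ge> 2"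
  defines "\<delta> \<equiv> real DIM('a) / \<alpha>"
  shows "(\<integral>\<^sup>+ x. ennreal (excess x) \<partial>lborel) =
    ennreal (measure lborel (ball (0::'a) 1) * r0 powr real DIM('a) * \<theta> powr \<delta> *
      (Gamma (1 + \<delta>) * Gamma (1 - \<delta>)) / ((real N - 1) powr (1 - \<delta>) * real N powr \<delta>))"
proof -
  define b where "b = \<theta> * r0 powr \<alpha> * ((real N - 1) / real N)"
  have \<alpha>0: "\<alpha> > 0"
    using \<alpha> by (meson of_nat_0_le_iff le_less_trans)
  have n: "real N - 1 > 0" "real N > 0"
    using N2 by auto
  have b: "b > 0"
    using theta r0 n by (simp add: b_def)
  have "(\<integral>\<^sup>+ x. ennreal (excess x) \<partial>lborel) =
      (\<integral>\<^sup>+ x. ennreal (1 / (real N - 1)) * ennreal (b / (b + norm (x::'a) powr \<alpha>)) \<partial>lborel)"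
  proof (rule nn_integral_cong_AE)
    \<comment> \<open>At the origin the two sides differ, since \<open>excess 0\<close> is 0 while
      the kernel equals 1 there.\<close>
    show "AE x in lborel. ennreal (excess x) =
        ennreal (1 / (real N - 1)) * ennreal (b / (b + norm (x::'a) powr \<alpha>))"
      using AE_lborel_singleton[of "0::'a"]
    proof eventually_elim
      case (elim x)
      define p where "p = norm x powr \<alpha>"
      have p: "p > 0" using elim by (simp add: p_def)
      have g: "gain x = \<theta> * r0 powr \<alpha> / p"
        by (simp add: gain_def p_def powr_minus_divide)
      have "gain x * (real N - 1) / real N = b / p"
        by (simp add: g b_def)
      moreover have "gain x / real N = 1 / (real N - 1) * (b / p)"
        using n by (simp add: g b_def)
      ultimately have "excess x = 1 / (real N - 1) * ((b / p) / (1 + b / p))"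
        by (simp add: excess_def)
      also have "(b / p) / (1 + b / p) = b / (b + p)"
        using p b by (simp add: field_simps)
      finally show ?case
        using n b p by (simp add: p_def ennreal_mult[symmetric])
    qed
  qed
  also have "\<dots> = ennreal (1 / (real N - 1)) *
      ennreal (measure lborel (ball (0::'a) 1) * b powr \<delta> * (Gamma (1 + \<delta>) * Gamma (1 - \<delta>)))"
    unfolding \<delta>_def using \<alpha> b by (subst nn_integral_cmult) (simp_all only: nn_integral_radial_Gamma, measurable)
  also have "\<dots> = ennreal (1 / (real N - 1) *
      (measure lborel (ball (0::'a) 1) * b powr \<delta> * (Gamma (1 + \<delta>) * Gamma (1 - \<delta>))))"
    using n by (intro ennreal_mult'[symmetric]) simp
  also have "b powr \<delta> = \<theta> powr \<delta> * r0 powr real DIM('a) * ((real N - 1) powr \<delta> / real N powr \<delta>)"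
    using theta r0 n \<alpha>0 by (simp add: b_def powr_mult powr_divide powr_powr \<delta>_def)
  also have "1 / (real N - 1) * (measure lborel (ball (0::'a) 1) *
      (\<theta> powr \<delta> * r0 powr real DIM('a) * ((real N - 1) powr \<delta> / real N powr \<delta>)) *
      (Gamma (1 + \<delta>) * Gamma (1 - \<delta>))) =
    measure lborel (ball (0::'a) 1) * r0 powr real DIM('a) * \<theta> powr \<delta> *
      (Gamma (1 + \<delta>) * Gamma (1 - \<delta>)) / ((real N - 1) powr (1 - \<delta>) * real N powr \<delta>)"
    using n by (simp add: powr_diff)
  finally show ?thesis .
qed

text \<open>With a single sub-band the denominator of \<open>excess\<close> is 1, so the full
  singularity of \<open>gain\<close> remains.\<close>

lemma nn_integral_excess_one:
  assumes "\<alpha> > real DIM('a)" "N = 1"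
  shows "(\<integral>\<^sup>+ x. ennreal (excess x) \<partial>lborel) = \<infinity>"
  unfolding excess_def gain_def
  using nn_integral_radial_infinite[OF assms(1), of "\<theta> * r0 powr \<alpha>"] assms(2) theta r0
  by simp

text \<open>Valid for every \<open>N\<close>, with a possibly infinite \<open>J\<close>; the number
  of sub-bands decides only which branch occurs.\<close>

lemma mean_local_delay:
  assumes PPP: "poisson_point_process M lam X" and lam: "lam > 0"
  defines "J \<equiv> \<integral>\<^sup>+ x. ennreal (excess x) \<partial>lborel"
  shows "(\<integral>\<^sup>+ \<omega>. local_delay (fh_success X h h0 S S0 \<alpha> r0 \<theta> N W N0) N \<omega> \<partial>M) =
    ennreal (real N * exp noise) * (if J = \<infinity> then \<infinity> else ennreal (exp (lam * enn2real J)))"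
proof -
  have "(\<integral>\<^sup>+ \<omega>. local_delay (fh_success X h h0 S S0 \<alpha> r0 \<theta> N W N0) N \<omega> \<partial>M) =
      (\<integral>\<^sup>+ \<omega>. ennreal (real N * exp noise) * (SUP m. ennreal (\<Prod>i<m. 1 + excess (X i \<omega>))) \<partial>M)"
    by (simp only: nn_integral_delay_points nn_integral_delay_at)
  also have "\<dots> = ennreal (real N * exp noise) *
      (\<integral>\<^sup>+ \<omega>. (SUP m. ennreal (\<Prod>i<m. 1 + excess (X i \<omega>))) \<partial>M)"
    by (rule nn_integral_cmult) measurable
  also have "(\<integral>\<^sup>+ \<omega>. (SUP m. ennreal (\<Prod>i<m. 1 + excess (X i \<omega>))) \<partial>M) =
      (if J = \<infinity> then \<infinity> else ennreal (exp (lam * enn2real J)))"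
    unfolding J_def by (rule poisson_pgfl[OF PPP lam excess_meas excess_nonneg])
  finally show ?thesis .
qed

end

theorem theorem1:
  fixes M :: "'w measure"
    and X :: "nat \<Rightarrow> 'w \<Rightarrow> 'a::euclidean_space"
    and h :: "nat \<Rightarrow> nat \<Rightarrow> 'w \<Rightarrow> real"
    and h0 :: "nat \<Rightarrow> 'w \<Rightarrow> real"
    and S :: "nat \<Rightarrow> nat \<Rightarrow> 'w \<Rightarrow> nat"
    and S0 :: "nat \<Rightarrow> 'w \<Rightarrow> nat"
    and lam \<alpha> r0 \<theta> W N0 :: real
    and N :: nat
  assumes M: "prob_space M"
    and lam: "lam > 0"
    and alpha: "\<alpha> > real DIM('a)"
    and r0: "r0 > 0"
    and theta: "\<theta> > 0"
    and W: "W > 0"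
    and N0: "N0 \<ge> 0"
    and N: "N \<ge> 1"
    and PPP: "poisson_point_process M lam X"
    and fad: "\<And>k i. distributed M lborel (h k i) (exponential_density 1)"
    and fad0: "\<And>k. distributed M lborel (h0 k) (exponential_density 1)"
    and hop: "\<And>k i. S k i \<in> measurable M (count_space UNIV) \<and>
                (\<forall>j\<in>{1..N}. measure M {\<omega> \<in> space M. S k i \<omega> = j} = 1 / real N)"
    and hop0: "\<And>k. S0 k \<in> measurable M (count_space UNIV) \<and>
                (\<forall>j\<in>{1..N}. measure M {\<omega> \<in> space M. S0 k \<omega> = j} = 1 / real N)"
    and indep: "prob_space.indep_sets M
       (\<lambda>j. case j of
              Pts \<Rightarrow> events_of M (Pi\<^sub>M UNIV (\<lambda>_. borel)) (\<lambda>\<omega> i. X i \<omega>)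
            | Fad k i \<Rightarrow> events_of M borel (h k i)
            | Fad0 k \<Rightarrow> events_of M borel (h0 k)
            | Hop k i \<Rightarrow> events_of M (count_space UNIV) (S k i)
            | Hop0 k \<Rightarrow> events_of M (count_space UNIV) (S0 k)) UNIV"
  shows "(\<integral>\<^sup>+ \<omega>. local_delay (fh_success X h h0 S S0 \<alpha> r0 \<theta> N W N0) N \<omega> \<partial>M) =
    (if N = 1 then \<infinity>
     else (let \<delta> = real DIM('a) / \<alpha>;
               A = lam * measure lborel (ball (0::'a) 1) * r0 powr real DIM('a) * \<theta> powr \<delta>
                   * (Gamma (1 + \<delta>) * Gamma (1 - \<delta>));
               B = \<theta> * r0 powr \<alpha> * W * N0
           in ennreal (real N * exp (A / ((real N - 1) powr (1 - \<delta>) * real N powr \<delta>)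
                                     + B / real N))))"
proof -
  interpret prob_space M by (rule M)
  interpret fhma M X h h0 S S0 \<alpha> r0 \<theta> W N0 N
    using PPP r0 theta W N0 N fad fad0 hop hop0 indep
    by unfold_locales (auto simp: poisson_point_process_def)
  define \<delta> where "\<delta> = real DIM('a) / \<alpha>"
  define A where "A = lam * measure lborel (ball (0::'a) 1) * r0 powr real DIM('a) * \<theta> powr \<delta>
                   * (Gamma (1 + \<delta>) * Gamma (1 - \<delta>))"
  show ?thesis
  proof (cases "N = 1")
    case True
    then show ?thesis
      using mean_local_delay[OF PPP lam] nn_integral_excess_one[OF alpha]
      by (simp add: ennreal_mult_top)
  next
    case False
    then have N2: "N \<ge> 2" using N by simp
    \<comment> \<open>The intensity is part of \<open>A\<close> but not of the integral of
      \<open>excess\<close>, hence the division by \<open>lam\<close>.\<close>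
    define J where "J = A / lam / ((real N - 1) powr (1 - \<delta>) * real N powr \<delta>)"
    have \<delta>: "0 < \<delta>" "\<delta> < 1"
      using alpha by (simp_all add: \<delta>_def le_less_trans[OF of_nat_0_le_iff])
    have J: "(\<integral>\<^sup>+ x. ennreal (excess x) \<partial>lborel) = ennreal J" "J \<ge> 0"
      using nn_integral_excess[OF alpha N2] lam \<delta> theta
      by (simp_all add: J_def A_def \<delta>_def[symmetric] Gamma_real_pos less_imp_le)
    have "(\<integral>\<^sup>+ \<omega>. local_delay (fh_success X h h0 S S0 \<alpha> r0 \<theta> N W N0) N \<omega> \<partial>M) =
        ennreal (real N * exp (lam * J + noise))"
      using J by (simp add: mean_local_delay[OF PPP lam] ennreal_mult[symmetric] exp_add mult_ac)
    also have "lam * J + noise = A / ((real N - 1) powr (1 - \<delta>) * real N powr \<delta>) +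
        \<theta> * r0 powr \<alpha> * W * N0 / real N"
      using lam by (simp add: J_def noise_def mult.assoc)
    finally show ?thesis
      using False by (simp add: Let_def A_def \<delta>_def)
  qed
qed

end
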